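(* Let $f(x):=\frac1n\sum_{i=1}^nf_i(x)$ on $\mathbb{R}^d$, where each $f_i:\mathbb{R}^d\to\mathbb{R}$ is $\mathcal{C}^2$, each $\nabla f_i$ is globally $\mathsf{L}$-Lipschitz with a common modulus $\mathsf{L}>0$, and the Hessians $\nabla^2f_i$, $i\in\{1,\dots,n\}$, are locally Lipschitz. Let $\{x^k\}_k$ be generated by random reshuffling with step-sizes $\{\eta_k\}_k$ satisfying $$0<\eta_k\le\frac1{4n\mathsf{L}},\qquad\sum_{k=0}^\infty\eta_k=\infty,\qquad\sum_{k=0}^\infty\eta_k^2<\infty .$$ If $x^0$ is drawn from any distribution with a density (with respect to Lebesgue measure on $\mathbb{R}^d$), then $$\mathbb{P}\Big(\lim_{k\to\infty}x^k\in\mathcal{X}^*\Big)=0,\qquad\mathcal{X}^*:=\{x\in\mathbb{R}^d:\nabla f(x)=0,\ \lambda_{\min}(\nabla^2f(x))<0\}.$$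
   Context: Random reshuffling: from $x^0$, for $k=0,1,2,\dots$ draw a permutation $\pi^k$ of $\{1,\dots,n\}$, set $y_0^k=x^k$, $y_i^k=y_{i-1}^k-\eta_k\nabla f_{\pi_i^k}(y_{i-1}^k)$ for $i=1,\dots,n$, and $x^{k+1}=y_n^k$. The step-sizes are deterministic, and the sequence of random permutations $\{\pi^k\}_k$ is independent of $x^0$ (no other condition on the law of $\{\pi^k\}_k$ is imposed). The event in the conclusion is that $\{x^k\}_k$ converges with limit in $\mathcal{X}^*$. *)

theory Defs
  imports "HOL-Probability.Probability" "HOL-Combinatorics.Permutations"
begin

section \<open>Gradient, Hessian, strict saddles\<close>

(* Only meaningful where f is differentiable; then GDERIV determines the vector uniquely. *)
definition grad :: "(real^'d \<Rightarrow> real) \<Rightarrow> real^'d \<Rightarrow> real^'d" where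
  "grad f x = (THE D. GDERIV f x :> D)"

lemma grad_eqI:
  fixes f :: "real^'d \<Rightarrow> real"
  assumes "GDERIV f x :> D"
  shows "grad f x = D"
  unfolding grad_def
proof (rule the_equality, fact assms)
  fix D' assume "GDERIV f x :> D'"
  then have "(\<lambda>h. h \<bullet> D') = (\<lambda>h. h \<bullet> D)"
    using assms has_derivative_unique unfolding gderiv_def by blast
  then show "D' = D"
    by (metis vector_eq_ldot)
qed

definition hessian :: "(real^'d \<Rightarrow> real) \<Rightarrow> real^'d \<Rightarrow> real^'d^'d" where
  "hessian f x = jacobian (grad f) (at x)"

definition twice_cont_diff :: "(real^'d \<Rightarrow> real) \<Rightarrow> bool" where
  "twice_cont_diff f \<longleftrightarrow>
     (\<forall>x. f differentiable (at x)) \<and>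
     (\<forall>x. grad f differentiable (at x)) \<and>
     continuous_on UNIV (hessian f)"

(* The norm on matrices is the Euclidean one on entries; as all norms on R^(d x d) are
   equivalent, the choice does not affect local Lipschitz continuity. *)
definition locally_lipschitz :: "('a::metric_space \<Rightarrow> 'b::metric_space) \<Rightarrow> bool" where
  "locally_lipschitz g \<longleftrightarrow> (\<forall>x. \<exists>r>0. \<exists>C. C-lipschitz_on (ball x r) g)"

(* Smallest real eigenvalue. It is applied to symmetric matrices, for which the set of real
   eigenvalues is finite and nonempty, so that Min is meaningful. *)
definition lambda_min :: "real^'d^'d \<Rightarrow> real" where
  "lambda_min A = Min {c. \<exists>v. v \<noteq> 0 \<and> A *v v = c *\<^sub>R v}"

definition strict_saddles :: "(real^'d \<Rightarrow> real) \<Rightarrow> (real^'d) set" where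
  "strict_saddles f = {x. grad f x = 0 \<and> lambda_min (hessian f x) < 0}"

section \<open>Random reshuffling\<close>

definition finite_sum_objective :: "nat \<Rightarrow> (nat \<Rightarrow> real^'d \<Rightarrow> real) \<Rightarrow> real^'d \<Rightarrow> real" where
  "finite_sum_objective n f x = (1 / real n) * (\<Sum>i=1..n. f i x)"

(* rr_inner f s p x i is the i-th inner iterate of an epoch started at x, with step-size s
   and permutation p. *)
primrec rr_inner ::
  "(nat \<Rightarrow> real^'d \<Rightarrow> real) \<Rightarrow> real \<Rightarrow> (nat \<Rightarrow> nat) \<Rightarrow> real^'d \<Rightarrow> nat \<Rightarrow> real^'d" where
  "rr_inner f s p x 0 = x"
| "rr_inner f s p x (Suc i) =
     rr_inner f s p x i - s *\<^sub>R grad (f (p (Suc i))) (rr_inner f s p x i)"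

primrec rr_iter ::
  "nat \<Rightarrow> (nat \<Rightarrow> real^'d \<Rightarrow> real) \<Rightarrow> (nat \<Rightarrow> real) \<Rightarrow> (nat \<Rightarrow> nat \<Rightarrow> nat) \<Rightarrow> real^'d
    \<Rightarrow> nat \<Rightarrow> real^'d" where
  "rr_iter n f \<eta> p x0 0 = x0"
| "rr_iter n f \<eta> p x0 (Suc k) = rr_inner f (\<eta> k) (p k) (rr_iter n f \<eta> p x0 k) n"

definition perm_space :: "nat \<Rightarrow> (nat \<Rightarrow> nat) measure" where
  "perm_space n = count_space {p. p permutes {1..n}}"

(* Independence of two random variables whose value types may differ: the library's indep_var
   requires both variables to have the same type. *)
definition (in prob_space) indep_rv ::
  "'b measure \<Rightarrow> ('a \<Rightarrow> 'b) \<Rightarrow> 'c measure \<Rightarrow> ('a \<Rightarrow> 'c) \<Rightarrow> bool" where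
  "indep_rv S X T Y \<longleftrightarrow>
     random_variable S X \<and> random_variable T Y \<and>
     indep_set {X -` A \<inter> space M | A. A \<in> sets S} {Y -` B \<inter> space M | B. B \<in> sets T}"

end

(* Fix the sequence of permutations. The difference z of two orbits that both stay in a small ball
   around a strict saddle a satisfies z' = (I - \<eta> A) z up to an error of at most \<eta> \<delta> |z| with \<delta> as
   small as we like, where A is n times the Hessian of the objective at a. Only differences of
   orbits matter, so a need not be a fixed point of the epoch maps and their O(\<eta>^2) drift plays no
   role. With e > 0 small and B = A + e I invertible and not positive semidefinite, the form
   Q z = z . B z decreases by at least const * \<eta> |z|^2 per epoch as long as Q z \<le> 0. Since the
   step-sizes are not summable, a bounded nonzero z must therefore have Q z > 0. Hence at any late
   epoch the trapped orbits lie in a set all of whose differences avoid a cone around a direction v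
   with Q v < 0. Such a set is a Lipschitz graph over a subset of the hyperplane orthogonal to v, so
   it is null, and since the epoch maps have Lipschitz inverses, so is the set of starting points.
   By Lindelof countably many such balls cover the strict saddles; independence and Fubini then
   average over the permutations. *)
theory Submission
  imports Defs
begin

section \<open>Symmetric matrices\<close>

lemma norm_matrix_vector_bound:
  fixes A :: "real^'n^'m"
  obtains C where "C > 0" "\<And>x. norm (A *v x) \<le> C * norm x"
  using linear_bounded_pos[OF matrix_vector_mul_linear[of A]] by blast

text \<open>Eigenvectors for distinct eigenvalues are orthogonal, so choosing one per eigenvalue
  gives an independent set, which is finite in finite dimension. This makes the \<open>Min\<close>
  in \<open>lambda_min\<close> meaningful and later leaves room for a shift that avoids the
  spectrum.\<close>

lemma finite_eigenvalues_symmetric: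
  fixes A :: "real^'d^'d"
  assumes sym: "\<And>x y. (A *v x) \<bullet> y = x \<bullet> (A *v y)"
  shows "finite {c. \<exists>v. v \<noteq> 0 \<and> A *v v = c *\<^sub>R v}"
proof -
  define E where "E = {c. \<exists>v. v \<noteq> 0 \<and> A *v v = c *\<^sub>R v}"
  have "\<forall>c\<in>E. \<exists>v. v \<noteq> 0 \<and> A *v v = c *\<^sub>R v"
    by (auto simp: E_def)
  then obtain e where e: "\<And>c. c \<in> E \<Longrightarrow> e c \<noteq> 0 \<and> A *v e c = c *\<^sub>R e c"
    by metis
  have orth: "e c \<bullet> e c' = 0" if "c \<in> E" "c' \<in> E" "c \<noteq> c'" for c c'
  proof -
    have "c * (e c \<bullet> e c') = c' * (e c \<bullet> e c')"
      using sym[of "e c" "e c'"] e that by simp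
    then show ?thesis using that by simp
  qed
  have inj: "inj_on e E"
    by (rule inj_onI) (metis e inner_eq_zero_iff orth)
  have "pairwise orthogonal (e ` E)"
    by (auto simp: pairwise_def orthogonal_def intro: orth)
  moreover have "0 \<notin> e ` E" using e by force
  ultimately have "independent (e ` E)"
    by (rule pairwise_orthogonal_independent)
  then have "finite (e ` E)" by (rule finiteI_independent)
  then show ?thesis
    using inj finite_imageD unfolding E_def by blast
qed

text \<open>The quadratic form attains its minimum over the compact unit sphere, and a first-order
  variation shows that the minimizer is an eigenvector whose eigenvalue is that minimum.\<close>

lemma symmetric_min_eigenvector:
  fixes A :: "real^'d^'d"
  assumes sym: "\<And>x y. (A *v x) \<bullet> y = x \<bullet> (A *v y)"
  obtains c u where "u \<noteq> 0" "A *v u = c *\<^sub>R u" "\<And>x. c * (x \<bullet> x) \<le> x \<bullet> (A *v x)"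
proof -
  let ?q = "\<lambda>x. x \<bullet> (A *v x)"
  have "continuous_on (sphere 0 1) ?q"
    by (intro continuous_intros matrix_vector_mult_linear_continuous_on)
  moreover have "sphere (0::real^'d) 1 \<noteq> {}" by simp
  ultimately obtain u where u: "u \<in> sphere 0 1" "\<And>y. y \<in> sphere 0 1 \<Longrightarrow> ?q u \<le> ?q y"
    using continuous_attains_inf[of "sphere 0 1" ?q] by auto
  define c where "c = ?q u"
  have low: "c * (x \<bullet> x) \<le> ?q x" for x
  proof (cases "x = 0")
    case False
    let ?y = "(1 / norm x) *\<^sub>R x"
    have "c \<le> ?q ?y" using False u(2)[of ?y] by (simp add: c_def)
    also have "?q ?y = ?q x / (x \<bullet> x)"
      by (simp add: matrix_vector_mult_scaleR power2_norm_eq_inner[symmetric] power2_eq_square)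
    finally show ?thesis using False by (simp add: field_simps)
  qed simp
  \<comment> \<open>half the gradient at u of x . A x - c (x . x), which attains its minimum 0 at u\<close>
  define w where "w = A *v u - c *\<^sub>R u"
  have "w \<bullet> w \<le> 0"
  proof (rule ccontr)
    assume "\<not> w \<bullet> w \<le> 0"
    then have pos: "w \<bullet> w > 0" by linarith
    \<comment> \<open>\<open>K\<close> is a positive upper bound for the coefficient of the square
      of \<open>t\<close> along the line through \<open>u\<close> in direction \<open>- w\<close>.
      With \<open>t\<close> the quotient below, the linear decrease is twice the quadratic error, so
      the shifted form becomes negative, against \<open>low\<close>.\<close>
    define K where "K = \<bar>?q w - c * (w \<bullet> w)\<bar> + 1"
    define t where "t = (w \<bullet> w) / K"
    have K: "K > 0" by (simp add: K_def add_nonneg_pos)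
    have t: "t > 0" using pos K by (simp add: t_def)
    have uu: "u \<bullet> u = 1" using u(1) by (simp add: norm_eq_1)
    let ?y = "u - t *\<^sub>R w"
    have "?q ?y - c * (?y \<bullet> ?y) = - 2 * t * (w \<bullet> w) + t\<^sup>2 * (?q w - c * (w \<bullet> w))"
    proof -
      have 1: "u \<bullet> (A *v w) = w \<bullet> (A *v u)" using sym[of u w] by (simp add: inner_commute)
      have 2: "A *v u = w + c *\<^sub>R u" by (simp add: w_def)
      have 3: "?q ?y = c - 2 * t * (w \<bullet> (A *v u)) + t\<^sup>2 * ?q w"
        by (simp add: matrix_vector_mult_diff_distrib matrix_vector_mult_scaleR inner_diff_left
            inner_diff_right 1 c_def power2_eq_square algebra_simps)
      have 4: "w \<bullet> (A *v u) = w \<bullet> w + c * (w \<bullet> u)" by (simp add: 2 inner_add_right)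
      have 5: "?y \<bullet> ?y = 1 - 2 * t * (w \<bullet> u) + t\<^sup>2 * (w \<bullet> w)"
        by (simp add: inner_diff_left inner_diff_right uu inner_commute power2_eq_square
            algebra_simps)
      show ?thesis unfolding 3 4 5 by algebra
    qed
    also have "\<dots> \<le> - 2 * t * (w \<bullet> w) + t\<^sup>2 * K"
      by (intro add_left_mono mult_left_mono) (auto simp: K_def)
    also have "\<dots> = - t * (w \<bullet> w)"
      using K by (simp add: t_def power2_eq_square field_simps)
    also have "\<dots> < 0" using t pos by simp
    finally show False using low[of ?y] by simp
  qed
  then have "w = 0" by (metis inner_gt_zero_iff linorder_not_less)
  then have "A *v u = c *\<^sub>R u" by (simp add: w_def)
  moreover have "u \<noteq> 0" using u(1) by auto
  ultimately show thesis using low that by blast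
qed

text \<open>The smallest eigenvalue is the minimum of the Rayleigh quotient. The form with a
  negative direction serves both the dynamics, which need such a \<open>v\<close>, and
  measurability, since it is an open condition.\<close>

lemma lambda_min_neg_iff:
  fixes A :: "real^'d^'d"
  assumes sym: "\<And>x y. (A *v x) \<bullet> y = x \<bullet> (A *v y)"
  shows "lambda_min A < 0 \<longleftrightarrow> (\<exists>v. v \<bullet> (A *v v) < 0)"
proof -
  let ?E = "{c. \<exists>v. v \<noteq> 0 \<and> A *v v = c *\<^sub>R v}"
  have fin: "finite ?E" by (rule finite_eigenvalues_symmetric[OF sym])
  obtain c u where cu: "u \<noteq> 0" "A *v u = c *\<^sub>R u" "\<And>x. c * (x \<bullet> x) \<le> x \<bullet> (A *v x)"
    using symmetric_min_eigenvector[OF sym] by blast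
  have cE: "c \<in> ?E" using cu by blast
  have "c \<le> c'" if "v \<noteq> 0" "A *v v = c' *\<^sub>R v" for c' v
  proof -
    have "c * (v \<bullet> v) \<le> c' * (v \<bullet> v)" using cu(3)[of v] by (simp add: that(2))
    then show ?thesis using that(1) by (simp add: mult_le_cancel_right)
  qed
  then have "lambda_min A = c"
    unfolding lambda_min_def using fin cE by (intro Min_eqI) auto
  moreover have "c < 0 \<longleftrightarrow> (\<exists>v. v \<bullet> (A *v v) < 0)"
  proof
    assume "c < 0"
    then have "u \<bullet> (A *v u) < 0" using cu(1) by (simp add: cu(2) mult_neg_pos)
    then show "\<exists>v. v \<bullet> (A *v v) < 0" by blast
  next
    assume "\<exists>v. v \<bullet> (A *v v) < 0"
    then obtain v where "v \<bullet> (A *v v) < 0" by blast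
    then have "c * (v \<bullet> v) < 0" using cu(3)[of v] by linarith
    then show "c < 0" by (metis inner_ge_zero linorder_not_less mult_nonneg_nonneg)
  qed
  ultimately show ?thesis by simp
qed

text \<open>A strict saddle may have a singular Hessian. A small shift by \<open>e\<close> removes
  the kernel, because only finitely many values of \<open>e\<close> are forbidden, while
  \<open>v\<close> remains a direction of negative curvature.\<close>

lemma symmetric_shift_bounded_below:
  fixes A :: "real^'d^'d"
  assumes sym: "\<And>x y. (A *v x) \<bullet> y = x \<bullet> (A *v y)" and neg: "v \<bullet> (A *v v) < 0"
  obtains e c where "e > 0" "c > 0" "v \<bullet> (A *v v) + e * (v \<bullet> v) < 0"
    "\<And>z. c * norm z \<le> norm (A *v z + e *\<^sub>R z)"
proof -
  let ?E = "{c. \<exists>v. v \<noteq> 0 \<and> A *v v = c *\<^sub>R v}"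
  have v: "v \<bullet> v > 0" using neg by (cases "v = 0") auto
  \<comment> \<open>\<open>m\<close> is minus the Rayleigh quotient of \<open>v\<close>; shifts
    below it keep the form negative at \<open>v\<close>.\<close>
  define m where "m = - (v \<bullet> (A *v v)) / (v \<bullet> v)"
  have m: "m > 0" using v neg by (simp add: m_def field_simps)
  have "infinite {0<..<m}" using m by simp
  moreover have "finite (uminus ` ?E)" by (intro finite_imageI finite_eigenvalues_symmetric[OF sym])
  ultimately obtain e where e: "e \<in> {0<..<m}" "e \<notin> uminus ` ?E"
    by (meson finite_subset subsetI)
  have lin: "linear (\<lambda>z. A *v z + e *\<^sub>R z)"
    by (intro linear_compose_add matrix_vector_mul_linear linear_scale_self)
  have "inj (\<lambda>z. A *v z + e *\<^sub>R z)"
  proof (subst linear_injective_0[OF lin], safe)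
    fix z assume z: "A *v z + e *\<^sub>R z = 0"
    show "z = 0"
    proof (rule ccontr)
      assume "z \<noteq> 0"
      moreover have "A *v z = (- e) *\<^sub>R z" using z by (simp add: eq_neg_iff_add_eq_0)
      ultimately have "- e \<in> ?E" by blast
      then have "- (- e) \<in> uminus ` ?E" by (rule imageI)
      then show False using e(2) by simp
    qed
  qed
  then obtain c where "c > 0" "\<And>z. c * norm z \<le> norm (A *v z + e *\<^sub>R z)"
    using linear_inj_bounded_below_pos[OF lin] by auto
  moreover have "v \<bullet> (A *v v) + e * (v \<bullet> v) < 0"
    using e(1) v by (simp add: m_def field_simps)
  ultimately show thesis using that e(1) by auto
qed

section \<open>Null sets\<close>

text \<open>The orthogonal projection \<open>P\<close> along \<open>v\<close> kills only multiples
  of \<open>v\<close>, where the form of \<open>B\<close> is not positive. Hence \<open>P\<close> is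
  injective on \<open>S\<close> with Lipschitz inverse, and \<open>S\<close> is a Lipschitz image of
  a subset of a hyperplane.\<close>

lemma negligible_if_differences_in_cone:
  fixes S :: "(real^'d) set" and B :: "real^'d^'d"
  assumes neg: "v \<bullet> (B *v v) < 0"
    and pos: "\<And>x y. x \<in> S \<Longrightarrow> y \<in> S \<Longrightarrow> x \<noteq> y \<Longrightarrow> 0 < (x - y) \<bullet> (B *v (x - y))"
  shows "negligible S"
proof -
  have v: "v \<bullet> v > 0" using neg by (cases "v = 0") auto
  define P where "P x = x - ((v \<bullet> x) / (v \<bullet> v)) *\<^sub>R v" for x
  have linP: "linear P"
    unfolding P_def by (rule linearI) (auto simp: algebra_simps inner_add_right add_divide_distrib)
  \<comment> \<open>The weak inequality makes \<open>K\<close> closed, hence compact, so that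
    nonvanishing of \<open>P\<close> on it improves to a uniform lower bound
    \<open>d\<close>.\<close>
  define K where "K = sphere 0 1 \<inter> {z. 0 \<le> z \<bullet> (B *v z)}"
  have "closed {z. 0 \<le> z \<bullet> (B *v z)}"
    by (intro closed_Collect_le continuous_intros matrix_vector_mult_linear_continuous_on)
  then have K: "compact K" unfolding K_def by (intro compact_Int_closed) auto
  have "\<exists>d>0. \<forall>z\<in>K. d \<le> norm (P z)"
  proof (cases "K = {}")
    case False
    have "continuous_on K (\<lambda>z. norm (P z))"
      using linP by (intro continuous_intros linear_continuous_on linear_conv_bounded_linear[THEN iffD1])
    then obtain u where u: "u \<in> K" "\<And>z. z \<in> K \<Longrightarrow> norm (P u) \<le> norm (P z)"
      using continuous_attains_inf[OF K False] by blast
    have "P u \<noteq> 0"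
    proof
      assume "P u = 0"
      then obtain s where s: "u = s *\<^sub>R v" by (auto simp: P_def)
      have "s \<noteq> 0" using u(1) s by (auto simp: K_def)
      moreover have "u \<bullet> (B *v u) = s\<^sup>2 * (v \<bullet> (B *v v))"
        by (simp add: s matrix_vector_mult_scaleR power2_eq_square)
      ultimately have "u \<bullet> (B *v u) < 0" using neg by (simp add: mult_pos_neg)
      then show False using u(1) by (simp add: K_def)
    qed
    then show ?thesis using u(2) by (intro exI[of _ "norm (P u)"]) auto
  qed (auto intro: exI[of _ 1])
  then obtain d where d: "d > 0" "\<And>z. z \<in> K \<Longrightarrow> d \<le> norm (P z)" by blast
  have below: "d * norm (x - y) \<le> norm (P x - P y)" if "x \<in> S" "y \<in> S" for x y
  proof (cases "x = y")
    case False
    let ?z = "x - y"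
    let ?w = "(1 / norm ?z) *\<^sub>R ?z"
    have "0 < ?w \<bullet> (B *v ?w)"
      using pos[OF that False] False by (simp add: matrix_vector_mult_scaleR)
    then have "?w \<in> K" using False by (simp add: K_def)
    then have "d \<le> norm (P ?w)" by (rule d)
    also have "P ?w = (1 / norm ?z) *\<^sub>R (P x - P y)"
      by (simp only: linear_scale[OF linP] linear_diff[OF linP])
    finally have "d \<le> norm (P x - P y) / norm ?z"
      by (simp del: scaleR_right_diff_distrib)
    then show ?thesis using False by (simp add: field_simps)
  qed simp
  have inj: "inj_on P S"
  proof (rule inj_onI)
    fix x y assume "x \<in> S" "y \<in> S" "P x = P y"
    then show "x = y" using below[of x y] d(1) by (simp add: mult_le_0_iff)
  qed
  have "P ` S \<subseteq> {x. v \<bullet> x = 0}"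
    using v by (auto simp: P_def inner_diff_right)
  then have "negligible (P ` S)"
    using v by (intro negligible_subset[OF negligible_hyperplane[of v 0]]) auto
  then have "negligible (inv_into S P ` P ` S)"
  proof (rule negligible_locally_Lipschitz_image[rotated])
    fix p assume p: "p \<in> P ` S"
    have "norm (inv_into S P y - inv_into S P p) \<le> (1 / d) * norm (y - p)" if "y \<in> P ` S" for y
      using below[of "inv_into S P y" "inv_into S P p"] that p d(1)
      by (simp add: inv_into_into f_inv_into_f field_simps)
    then show "\<exists>T B. open T \<and> p \<in> T \<and>
         (\<forall>y\<in>P ` S \<inter> T. norm (inv_into S P y - inv_into S P p) \<le> B * norm (y - p))"
      by (intro exI[of _ UNIV] exI[of _ "1 / d"]) auto
  qed simp
  then show ?thesis using inj by simp
qed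

text \<open>A lower Lipschitz bound makes the inverse on the image Lipschitz, and Lipschitz maps
  between spaces of equal dimension preserve null sets. This pulls null sets back from a late epoch
  to the starting points.\<close>

lemma negligible_if_expanding_image:
  fixes T :: "'a::euclidean_space \<Rightarrow> 'a"
  assumes c: "c > 0" and exp: "\<And>x y. c * norm (x - y) \<le> norm (T x - T y)"
    and N: "negligible (T ` S)"
  shows "negligible S"
proof -
  have inj: "inj_on T S"
  proof (rule inj_onI)
    fix x y assume "T x = T y"
    then show "x = y" using exp[of x y] c by (simp add: mult_le_0_iff)
  qed
  have "negligible (inv_into S T ` T ` S)"
  proof (rule negligible_locally_Lipschitz_image[OF order.refl N])
    fix p assume p: "p \<in> T ` S"
    have "norm (inv_into S T y - inv_into S T p) \<le> (1 / c) * norm (y - p)" if "y \<in> T ` S" for y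
      using exp[of "inv_into S T y" "inv_into S T p"] that p c
      by (simp add: inv_into_into f_inv_into_f field_simps)
    then show "\<exists>U B. open U \<and> p \<in> U \<and>
         (\<forall>y\<in>T ` S \<inter> U. norm (inv_into S T y - inv_into S T p) \<le> B * norm (y - p))"
      by (intro exI[of _ UNIV] exI[of _ "1 / c"]) auto
  qed
  then show ?thesis using inj by simp
qed

section \<open>Perturbed linear orbits\<close>

text \<open>The form of \<open>B\<close> is a Lyapunov function on the region where it is not
  positive. The orbit and its step-sizes are quantified inside the conclusion because
  \<open>B\<close>, \<delta> and \<open>h0\<close> must be fixed before the ball around the saddle,
  which depends on \<delta>, is chosen.\<close>

lemma bounded_perturbed_orbits_in_cone:
  fixes A :: "real^'d^'d"
  assumes sym: "\<And>x y. (A *v x) \<bullet> y = x \<bullet> (A *v y)" and neg: "v \<bullet> (A *v v) < 0"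
  obtains B :: "real^'d^'d" and \<delta> h0 :: real
  where "\<delta> > 0" "h0 > 0" "v \<bullet> (B *v v) < 0"
    "\<forall>(z :: nat \<Rightarrow> real^'d) h.
       (\<forall>k. 0 < h k \<and> h k \<le> h0) \<longrightarrow> \<not> summable h \<longrightarrow> bounded (range z) \<longrightarrow> z 0 \<noteq> 0 \<longrightarrow>
       (\<forall>k. norm (z (Suc k) - (z k - h k *\<^sub>R (A *v z k))) \<le> h k * \<delta> * norm (z k)) \<longrightarrow>
       0 < z 0 \<bullet> (B *v z 0)"
proof -
  obtain e c where e: "e > 0" and c: "c > 0" and ev: "v \<bullet> (A *v v) + e * (v \<bullet> v) < 0"
    and low: "\<And>z. c * norm z \<le> norm (A *v z + e *\<^sub>R z)"
    using symmetric_shift_bounded_below[OF sym neg] by blast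
  define B where "B = A + e *\<^sub>R mat 1"
  have B: "B *v z = A *v z + e *\<^sub>R z" for z
    by (simp add: B_def matrix_vector_mult_add_rdistrib scaleR_matrix_vector_assoc[symmetric])
  have symB: "(B *v x) \<bullet> y = x \<bullet> (B *v y)" for x y
    by (simp add: B inner_add_left inner_add_right sym)
  obtain a where a: "a > 0" "\<And>z. norm (A *v z) \<le> a * norm z"
    using norm_matrix_vector_bound[of A] by blast
  obtain b where b: "b > 0" "\<And>z. norm (B *v z) \<le> b * norm z"
    using norm_matrix_vector_bound[of B] by blast
  have inB: "\<bar>x \<bullet> (B *v y)\<bar> \<le> b * (norm x * norm y)" for x y
  proof -
    have "\<bar>x \<bullet> (B *v y)\<bar> \<le> norm x * norm (B *v y)" by (rule Cauchy_Schwarz_ineq2)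
    also have "\<dots> \<le> norm x * (b * norm y)" by (intro mult_left_mono b) auto
    finally show ?thesis by (simp add: mult_ac)
  qed
  define Q where "Q z = z \<bullet> (B *v z)" for z
  \<comment> \<open>The main term contributes a decrease of 2 \<open>h\<close> c^2 |z|^2. The choice
    of \<delta> limits the cross term with the remainder, and that of \<open>h0\<close> the
    second-order term, to a quarter of this each; half of the decrease survives.\<close>
  define \<delta> where "\<delta> = min 1 (c\<^sup>2 / (4 * b))"
  define h0 where "h0 = c\<^sup>2 / (2 * b * (a + 1)\<^sup>2)"
  have \<delta>: "\<delta> > 0" "\<delta> \<le> 1" "2 * \<delta> * b \<le> c\<^sup>2 / 2"
  proof -
    show "\<delta> > 0" "\<delta> \<le> 1" using b c by (auto simp: \<delta>_def)
    have "\<delta> \<le> c\<^sup>2 / (4 * b)" by (simp add: \<delta>_def)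
    then show "2 * \<delta> * b \<le> c\<^sup>2 / 2" using b by (simp add: field_simps)
  qed
  have h0: "h0 > 0" using a b c by (simp add: h0_def)
  have step: "Q z' \<le> Q z - h * c\<^sup>2 * (norm z)\<^sup>2"
    if h: "0 < h" "h \<le> h0" and Qz: "Q z \<le> 0"
      and R: "norm (z' - (z - h *\<^sub>R (A *v z))) \<le> h * \<delta> * norm z" for z z' h
  proof -
    define r where "r = z' - (z - h *\<^sub>R (A *v z))"
    define w where "w = r - h *\<^sub>R (A *v z)"
    have z': "z' = z + w" by (simp add: w_def r_def)
    have "Q z' = Q z + 2 * (w \<bullet> (B *v z)) + w \<bullet> (B *v w)"
      using symB[of z w]
      by (simp add: Q_def z' matrix_vector_right_distrib inner_add_left inner_add_right inner_commute)
    \<comment> \<open>Writing \<open>A\<close> as \<open>B\<close> minus the shift produces the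
      square of |B z|, which is bounded below, and a multiple of \<open>Q z\<close>, whose sign is
      favourable as long as \<open>Q z\<close> is not positive.\<close>
    also have "w \<bullet> (B *v z) = r \<bullet> (B *v z) - h * ((norm (B *v z))\<^sup>2 - e * Q z)"
    proof -
      have Az: "A *v z = B *v z - e *\<^sub>R z" by (simp add: B)
      show ?thesis
        by (simp add: w_def Az inner_diff_left power2_norm_eq_inner Q_def)
    qed
    finally have 1: "Q z' = Q z + 2 * (r \<bullet> (B *v z)) - 2 * h * (norm (B *v z))\<^sup>2
        + 2 * h * e * Q z + w \<bullet> (B *v w)"
      by (simp add: algebra_simps)
    have nr: "norm r \<le> h * \<delta> * norm z" using R by (simp add: r_def)
    have "r \<bullet> (B *v z) \<le> b * (norm r * norm z)" using inB[of r z] by linarith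
    also have "\<dots> \<le> b * (h * \<delta> * norm z * norm z)"
      using b nr by (intro mult_left_mono mult_right_mono) auto
    finally have "2 * (r \<bullet> (B *v z)) \<le> (2 * \<delta> * b) * (h * (norm z)\<^sup>2)"
      by (simp add: power2_eq_square algebra_simps)
    also have "\<dots> \<le> (c\<^sup>2 / 2) * (h * (norm z)\<^sup>2)"
      using h by (intro mult_right_mono \<delta>) auto
    finally have 2: "2 * (r \<bullet> (B *v z)) \<le> (c\<^sup>2 / 2) * (h * (norm z)\<^sup>2)" .
    have "norm w \<le> norm r + h * norm (A *v z)"
      using norm_triangle_ineq4[of r "h *\<^sub>R (A *v z)"] h by (simp add: w_def)
    also have "\<dots> \<le> h * \<delta> * norm z + h * (a * norm z)"
      using h a nr by (intro add_mono mult_left_mono) auto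
    also have "\<dots> \<le> h * 1 * norm z + h * (a * norm z)"
      using h \<delta> by (intro add_mono mult_left_mono mult_right_mono) auto
    finally have nw: "norm w \<le> h * (a + 1) * norm z" by (simp add: algebra_simps)
    have "w \<bullet> (B *v w) \<le> b * (norm w)\<^sup>2"
      using inB[of w w] by (simp add: power2_eq_square)
    also have "\<dots> \<le> b * (h * (a + 1) * norm z)\<^sup>2"
      using b nw by (intro mult_left_mono power_mono) auto
    also have "\<dots> = h * (b * (a + 1)\<^sup>2) * (h * (norm z)\<^sup>2)"
      by (simp add: power2_eq_square algebra_simps)
    also have "\<dots> \<le> h0 * (b * (a + 1)\<^sup>2) * (h * (norm z)\<^sup>2)"
      using h b by (intro mult_right_mono) auto
    also have "h0 * (b * (a + 1)\<^sup>2) = c\<^sup>2 / 2"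
      using a b by (simp add: h0_def)
    finally have 3: "w \<bullet> (B *v w) \<le> (c\<^sup>2 / 2) * (h * (norm z)\<^sup>2)" .
    have "(c * norm z)\<^sup>2 \<le> (norm (B *v z))\<^sup>2"
      using c low[of z] by (intro power_mono) (auto simp: B)
    then have 4: "2 * h * (c\<^sup>2 * (norm z)\<^sup>2) \<le> 2 * h * (norm (B *v z))\<^sup>2"
      using h by (intro mult_left_mono) (auto simp: power_mult_distrib)
    have 5: "2 * h * e * Q z \<le> 0"
      using h e Qz by (simp add: mult_nonneg_nonpos)
    show ?thesis using 1 2 3 4 5 by (simp add: algebra_simps)
  qed
  show thesis
  proof (rule that[OF \<delta>(1) h0])
    show "v \<bullet> (B *v v) < 0" using ev by (simp add: B inner_add_right)
    show "\<forall>(z :: nat \<Rightarrow> real^'d) h.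
       (\<forall>k. 0 < h k \<and> h k \<le> h0) \<longrightarrow> \<not> summable h \<longrightarrow> bounded (range z) \<longrightarrow> z 0 \<noteq> 0 \<longrightarrow>
       (\<forall>k. norm (z (Suc k) - (z k - h k *\<^sub>R (A *v z k))) \<le> h k * \<delta> * norm (z k)) \<longrightarrow>
       0 < z 0 \<bullet> (B *v z 0)"
    proof (intro allI impI)
      fix z :: "nat \<Rightarrow> real^'d" and h
      assume h: "\<forall>k. 0 < h k \<and> h k \<le> h0" and ns: "\<not> summable h" and bd: "bounded (range z)"
        and z0: "z 0 \<noteq> 0"
        and R: "\<forall>k. norm (z (Suc k) - (z k - h k *\<^sub>R (A *v z k))) \<le> h k * \<delta> * norm (z k)"
      note h = h[rule_format] and R = R[rule_format]
      show "0 < z 0 \<bullet> (B *v z 0)"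
      proof (rule ccontr)
        assume "\<not> 0 < z 0 \<bullet> (B *v z 0)"
        then have Q0: "Q (z 0) \<le> 0" by (simp add: Q_def)
        have st: "Q (z (Suc k)) \<le> Q (z k) - h k * c\<^sup>2 * (norm (z k))\<^sup>2" if "Q (z k) \<le> 0" for k
          using h R that by (intro step) auto
        have dec: "Q (z (Suc k)) \<le> Q (z k)" if "Q (z k) \<le> 0" for k
        proof -
          have "0 \<le> h k * c\<^sup>2 * (norm (z k))\<^sup>2" using h[of k] by simp
          then show ?thesis using st[OF that] by linarith
        qed
        have Qneg: "Q (z k) \<le> 0" for k
        proof (induction k)
          case (Suc k)
          then show ?case using dec by force
        qed (rule Q0)
        have decs: "Q (z (Suc k)) \<le> Q (z 1)" for k
        proof (induction k)
          case (Suc k)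
          then show ?case using dec[OF Qneg, of "Suc k"] by linarith
        qed simp
        \<comment> \<open>Index 1 is used because \<open>Q (z 0)\<close> may vanish, whereas one
          step from a nonzero \<open>z 0\<close> makes \<open>Q\<close> strictly negative. From then
          on |Q| is at least \<open>q\<close>, which keeps |z|^2 above q / b and every later
          decrease proportional to its step-size.\<close>
        define q where "q = - Q (z 1)"
        have q: "q > 0"
        proof -
          have "0 < h 0 * c\<^sup>2 * (norm (z 0))\<^sup>2" using h[of 0] c z0 by simp
          then show ?thesis using st[OF Q0] Q0 by (simp add: q_def)
        qed
        have absQ: "\<bar>Q x\<bar> \<le> b * (norm x)\<^sup>2" for x
          using inB[of x x] by (simp add: Q_def power2_eq_square)
        have st': "Q (z (Suc (Suc k))) \<le> Q (z (Suc k)) - h (Suc k) * (c\<^sup>2 * q / b)" for k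
        proof -
          have "q \<le> b * (norm (z (Suc k)))\<^sup>2"
            using absQ[of "z (Suc k)"] decs[of k] by (simp add: q_def)
          then have "c\<^sup>2 * q / b \<le> c\<^sup>2 * (norm (z (Suc k)))\<^sup>2"
            using b c by (simp add: field_simps)
          then have "h (Suc k) * (c\<^sup>2 * q / b) \<le> h (Suc k) * (c\<^sup>2 * (norm (z (Suc k)))\<^sup>2)"
            using h[of "Suc k"] by (intro mult_left_mono) auto
          then show ?thesis using st[OF Qneg, of "Suc k"] by (simp add: mult.assoc)
        qed
        have sm: "Q (z (Suc N)) \<le> Q (z 1) - (\<Sum>k<N. h (Suc k)) * (c\<^sup>2 * q / b)" for N
        proof (induction N)
          case (Suc N)
          then show ?case using st'[of N] unfolding sum.lessThan_Suc distrib_right by linarith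
        qed simp
        obtain D where D: "\<And>k. norm (z k) \<le> D"
          using bd by (auto simp: bounded_iff)
        have bdd: "(\<Sum>k<N. h (Suc k)) \<le> b * D\<^sup>2 / (c\<^sup>2 * q / b)" for N
        proof -
          have "(\<Sum>k<N. h (Suc k)) * (c\<^sup>2 * q / b) \<le> - Q (z (Suc N))"
            using sm[of N] q by (simp add: q_def)
          also have "\<dots> \<le> b * (norm (z (Suc N)))\<^sup>2" using absQ[of "z (Suc N)"] by linarith
          also have "\<dots> \<le> b * D\<^sup>2" using b D by (intro mult_left_mono power_mono) auto
          finally show ?thesis
            using b c q by (subst pos_le_divide_eq) auto
        qed
        have "summable (\<lambda>k. h (Suc k))"
        proof (rule bounded_imp_summable)
          show "0 \<le> h (Suc k)" for k using h[of "Suc k"] by simp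
          show "(\<Sum>k\<le>N. h (Suc k)) \<le> b * D\<^sup>2 / (c\<^sup>2 * q / b)" for N
            using bdd[of "Suc N"] by (simp only: lessThan_Suc_atMost)
        qed
        then show False using ns by (simp add: summable_Suc_iff)
      qed
    qed
  qed
qed

section \<open>Strict derivatives and symmetry of the Hessian\<close>

text \<open>A continuous derivative is a strict derivative: the mean value inequality is applied to
  \<open>g\<close> minus its linear part at \<open>a\<close>, whose derivative is small near
  \<open>a\<close>. The sum of absolute entries serves as a bound for the operator norm.\<close>

lemma strict_derivative_matrix:
  fixes g :: "real^'n \<Rightarrow> real^'m" and G :: "real^'n \<Rightarrow> real^'n^'m"
  assumes der: "\<And>x. (g has_derivative (\<lambda>h. G x *v h)) (at x)"
    and cont: "isCont G a" and \<delta>: "\<delta> > 0"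
  obtains \<rho> where "\<rho> > 0"
    "\<And>x y. x \<in> ball a \<rho> \<Longrightarrow> y \<in> ball a \<rho> \<Longrightarrow> norm (g x - g y - G a *v (x - y)) \<le> \<delta> * norm (x - y)"
proof -
  let ?s = "\<lambda>x. \<Sum>i\<in>UNIV. \<Sum>j\<in>UNIV. \<bar>(G x - G a) $ i $ j\<bar>"
  have "(?s \<longlongrightarrow> (\<Sum>i\<in>UNIV. \<Sum>j\<in>UNIV. \<bar>(G a - G a) $ i $ j\<bar>)) (at a)"
    using cont unfolding isCont_def by (intro tendsto_intros)
  then have "(?s \<longlongrightarrow> 0) (at a)" by simp
  then have "\<forall>\<^sub>F x in at a. ?s x < \<delta>" using \<delta> by (rule order_tendstoD)
  then obtain \<rho> where \<rho>: "\<rho> > 0" "\<And>x. x \<noteq> a \<Longrightarrow> dist x a < \<rho> \<Longrightarrow> ?s x < \<delta>"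
    by (auto simp: eventually_at)
  have s: "?s x \<le> \<delta>" if "x \<in> ball a \<rho>" for x
    using \<rho>(2)[of x] that \<delta> by (cases "x = a") (auto simp: dist_commute)
  have "norm (g x - g y - G a *v (x - y)) \<le> \<delta> * norm (x - y)"
    if "x \<in> ball a \<rho>" "y \<in> ball a \<rho>" for x y
  proof -
    have "norm ((g x - G a *v x) - (g y - G a *v y)) \<le> \<delta> * norm (x - y)"
    proof (rule differentiable_bound[where S = "ball a \<rho>" and f' = "\<lambda>x h. (G x - G a) *v h"])
      fix u assume u: "u \<in> ball a \<rho>"
      have "((\<lambda>x. g x - G a *v x) has_derivative (\<lambda>h. G u *v h - G a *v h)) (at u)"
        by (intro has_derivative_diff der linear_imp_has_derivative matrix_vector_mul_linear)
      then show "((\<lambda>x. g x - G a *v x) has_derivative (\<lambda>h. (G u - G a) *v h)) (at u within ball a \<rho>)"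
        by (simp add: matrix_vector_mult_diff_rdistrib has_derivative_at_withinI)
      show "onorm ((*v) (G u - G a)) \<le> \<delta>"
        using onorm_le_matrix_component_sum[of "G u - G a"] s[OF u] by linarith
    qed (use that in auto)
    then show ?thesis by (simp add: matrix_vector_mult_diff_distrib algebra_simps)
  qed
  then show thesis using that \<rho>(1) by blast
qed

text \<open>The adjoint of the derivative, evaluated at 1, is its Riesz representative, so the
  description in \<open>grad\<close> does denote the gradient at points of
  differentiability.\<close>

lemma gderiv_grad:
  fixes f :: "real^'d \<Rightarrow> real"
  assumes "f differentiable (at x)"
  shows "GDERIV f x :> grad f x"
proof -
  obtain f' where f': "(f has_derivative f') (at x)"
    using assms by (auto simp: differentiable_def)
  have "f' h = h \<bullet> adjoint f' 1" for h
    using adjoint_works[OF has_derivative_linear[OF f'], of h 1] by simp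
  then have "f' = (\<lambda>h. h \<bullet> adjoint f' 1)" by blast
  then have "GDERIV f x :> adjoint f' 1" using f' by (simp add: gderiv_def)
  then show ?thesis using grad_eqI by metis
qed

lemma twice_cont_diffD:
  fixes f :: "real^'d \<Rightarrow> real"
  assumes "twice_cont_diff f"
  shows "(f has_derivative (\<lambda>h. h \<bullet> grad f x)) (at x)"
    and "(grad f has_derivative (\<lambda>h. hessian f x *v h)) (at x)"
    and "isCont (hessian f) x"
proof -
  show "(f has_derivative (\<lambda>h. h \<bullet> grad f x)) (at x)"
    using gderiv_grad[of f x] assms by (simp add: twice_cont_diff_def gderiv_def)
  show "(grad f has_derivative (\<lambda>h. hessian f x *v h)) (at x)"
    using assms by (simp add: twice_cont_diff_def hessian_def jacobian_works)
  show "isCont (hessian f) x"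
    using assms by (simp add: twice_cont_diff_def continuous_on_eq_continuous_at)
qed

text \<open>One mean value theorem along \<open>v\<close> turns the mixed second difference into a
  difference of gradients, and strict differentiability evaluates that difference. The second
  difference does not change when \<open>u\<close> and \<open>v\<close> are swapped, which is what
  yields symmetry of the Hessian.\<close>

lemma second_difference_bound:
  fixes f :: "real^'d \<Rightarrow> real"
  assumes der: "\<And>x. (f has_derivative (\<lambda>h. h \<bullet> g x)) (at x)"
    and strict: "\<And>x y. x \<in> ball a \<rho> \<Longrightarrow> y \<in> ball a \<rho> \<Longrightarrow>
        norm (g x - g y - A *v (x - y)) \<le> \<delta> * norm (x - y)"
    and s: "s > 0" "s * (norm u + norm v) < \<rho>"
  shows "\<bar>f (a + s *\<^sub>R u + s *\<^sub>R v) - f (a + s *\<^sub>R u) - f (a + s *\<^sub>R v) + f a - s\<^sup>2 * (v \<bullet> (A *v u))\<bar>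
    \<le> s\<^sup>2 * (\<delta> * norm u * norm v)"
proof -
  define \<phi> where "\<phi> t = f (a + s *\<^sub>R u + t *\<^sub>R v) - f (a + t *\<^sub>R v)" for t
  have d\<phi>: "(\<phi> has_real_derivative (v \<bullet> (g (a + s *\<^sub>R u + t *\<^sub>R v) - g (a + t *\<^sub>R v)))) (at t)" for t
  proof -
    have 1: "((\<lambda>t. f (b + t *\<^sub>R v)) has_derivative (\<lambda>h. (h *\<^sub>R v) \<bullet> g (b + t *\<^sub>R v))) (at t)" for b
    proof (rule has_derivative_compose[OF _ der])
      show "((\<lambda>t. b + t *\<^sub>R v) has_derivative (\<lambda>h. h *\<^sub>R v)) (at t)"
        by (auto intro!: derivative_eq_intros)
    qed
    show ?thesis
      unfolding has_field_derivative_def \<phi>_def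
      by (rule has_derivative_eq_rhs[OF has_derivative_diff[OF 1 1]])
        (auto simp: inner_diff_right algebra_simps)
  qed
  obtain t where t: "0 < t" "t < s"
    "\<phi> s - \<phi> 0 = (s - 0) * (v \<bullet> (g (a + s *\<^sub>R u + t *\<^sub>R v) - g (a + t *\<^sub>R v)))"
    using MVT2[OF s(1), of \<phi> "\<lambda>t. v \<bullet> (g (a + s *\<^sub>R u + t *\<^sub>R v) - g (a + t *\<^sub>R v))"] d\<phi> by blast
  let ?x = "a + s *\<^sub>R u + t *\<^sub>R v" and ?y = "a + t *\<^sub>R v"
  have tv: "t * norm v \<le> s * norm v" using t by (intro mult_right_mono) auto
  have "norm (s *\<^sub>R u + t *\<^sub>R v) \<le> s * norm u + t * norm v"
    using norm_triangle_ineq[of "s *\<^sub>R u" "t *\<^sub>R v"] s t by simp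
  then have "?x \<in> ball a \<rho>" using s(2) tv
    by (simp add: dist_norm algebra_simps norm_minus_commute)
  moreover have "?y \<in> ball a \<rho>"
    using s t tv by (simp add: dist_norm distrib_left)
       (smt (verit) mult_nonneg_nonneg norm_ge_zero)
  ultimately have "norm (g ?x - g ?y - A *v (?x - ?y)) \<le> \<delta> * norm (?x - ?y)"
    by (rule strict)
  then have n: "norm (g ?x - g ?y - s *\<^sub>R (A *v u)) \<le> \<delta> * (s * norm u)"
    using s by (simp add: matrix_vector_mult_scaleR)
  have "\<phi> s - \<phi> 0 - s\<^sup>2 * (v \<bullet> (A *v u)) = s * (v \<bullet> (g ?x - g ?y - s *\<^sub>R (A *v u)))"
    by (simp add: t(3) inner_diff_right power2_eq_square algebra_simps)
  also have "\<bar>\<dots>\<bar> \<le> s * (norm v * norm (g ?x - g ?y - s *\<^sub>R (A *v u)))"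
    using s Cauchy_Schwarz_ineq2[of v "g ?x - g ?y - s *\<^sub>R (A *v u)"] by (simp add: abs_mult)
  also have "\<dots> \<le> s * (norm v * (\<delta> * (s * norm u)))"
    using s n by (intro mult_left_mono) auto
  finally show ?thesis by (simp add: \<phi>_def power2_eq_square algebra_simps)
qed

lemma hessian_symmetric:
  fixes f :: "real^'d \<Rightarrow> real"
  assumes f: "twice_cont_diff f"
  shows "(hessian f a *v u) \<bullet> v = u \<bullet> (hessian f a *v v)"
proof -
  let ?A = "hessian f a"
  have "\<bar>v \<bullet> (?A *v u) - u \<bullet> (?A *v v)\<bar> \<le> e" if e: "e > 0" for e
  proof -
    \<comment> \<open>The two orders of differencing each contribute an error \<delta> |u| |v|; the
      summand 1 keeps the quotient below defined if \<open>u\<close> or \<open>v\<close> is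
      zero.\<close>
    define K where "K = 2 * (norm u * norm v) + 1"
    have K: "K > 0" by (simp add: K_def add_nonneg_pos)
    define \<delta> where "\<delta> = e / K"
    have \<delta>: "\<delta> > 0" using e K by (simp add: \<delta>_def)
    obtain \<rho> where \<rho>: "\<rho> > 0" and st: "\<And>x y. x \<in> ball a \<rho> \<Longrightarrow> y \<in> ball a \<rho> \<Longrightarrow>
        norm (grad f x - grad f y - ?A *v (x - y)) \<le> \<delta> * norm (x - y)"
      using strict_derivative_matrix[OF twice_cont_diffD(2,3)[OF f] \<delta>, of a] by blast
    \<comment> \<open>Small enough that all points of the second difference stay in the ball of
      radius \<rho>; the summand 1 again excludes a zero denominator.\<close>
    define s where "s = \<rho> / (2 * (norm u + norm v + 1))"
    have nn: "norm u + norm v + 1 > 0" by (simp add: add_nonneg_pos)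
    have s: "s > 0" using \<rho> nn by (simp add: s_def)
    have "s * (norm u + norm v) \<le> s * (norm u + norm v + 1)" using s by simp
    also have "\<dots> = \<rho> / 2" using nn by (simp add: s_def field_simps)
    also have "\<dots> < \<rho>" using \<rho> by simp
    finally have s2: "s * (norm u + norm v) < \<rho>" .
    let ?D = "f (a + s *\<^sub>R u + s *\<^sub>R v) - f (a + s *\<^sub>R u) - f (a + s *\<^sub>R v) + f a"
    have 1: "\<bar>?D - s\<^sup>2 * (v \<bullet> (?A *v u))\<bar> \<le> s\<^sup>2 * (\<delta> * norm u * norm v)"
      by (rule second_difference_bound[OF twice_cont_diffD(1)[OF f] st s s2])
    have 2: "\<bar>f (a + s *\<^sub>R v + s *\<^sub>R u) - f (a + s *\<^sub>R v) - f (a + s *\<^sub>R u) + f a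
        - s\<^sup>2 * (u \<bullet> (?A *v v))\<bar> \<le> s\<^sup>2 * (\<delta> * norm v * norm u)"
      using s2 by (intro second_difference_bound[OF twice_cont_diffD(1)[OF f] st s])
        (auto simp: add.commute)
    have sw: "a + s *\<^sub>R v + s *\<^sub>R u = a + s *\<^sub>R u + s *\<^sub>R v" by (simp add: add_ac)
    have mc: "\<delta> * norm v * norm u = \<delta> * norm u * norm v" by simp
    have "\<bar>s\<^sup>2 * (v \<bullet> (?A *v u)) - s\<^sup>2 * (u \<bullet> (?A *v v))\<bar> \<le> 2 * (s\<^sup>2 * (\<delta> * norm u * norm v))"
      using 1 2 unfolding sw mc by linarith
    also have "s\<^sup>2 * (v \<bullet> (?A *v u)) - s\<^sup>2 * (u \<bullet> (?A *v v)) = s\<^sup>2 * (v \<bullet> (?A *v u) - u \<bullet> (?A *v v))"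
      by (simp add: right_diff_distrib)
    finally have "s\<^sup>2 * \<bar>v \<bullet> (?A *v u) - u \<bullet> (?A *v v)\<bar> \<le> s\<^sup>2 * (\<delta> * (2 * (norm u * norm v)))"
      by (simp add: abs_mult mult_ac)
    then have "\<bar>v \<bullet> (?A *v u) - u \<bullet> (?A *v v)\<bar> \<le> \<delta> * (2 * (norm u * norm v))"
      using s by simp
    also have "\<dots> \<le> \<delta> * K" using \<delta> by (simp add: K_def)
    also have "\<dots> = e" using K by (simp add: \<delta>_def)
    finally show ?thesis .
  qed
  then have "\<bar>v \<bullet> (?A *v u) - u \<bullet> (?A *v v)\<bar> \<le> 0"
    by (rule field_le_epsilon[of _ 0, simplified])
  then show ?thesis by (simp add: inner_commute)
qed

section \<open>Epochs of random reshuffling\<close>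

lemma matrix_vector_mult_sum_left:
  fixes A :: "'i \<Rightarrow> real^'n^'m"
  shows "(\<Sum>i\<in>I. A i) *v x = (\<Sum>i\<in>I. A i *v x)"
  by (induction I rule: infinite_finite_induct) (auto simp: matrix_vector_mult_add_rdistrib)

lemma jacobian_eqI:
  fixes g :: "real^'n \<Rightarrow> real^'m"
  assumes "(g has_derivative (\<lambda>h. A *v h)) (at x)"
  shows "jacobian g (at x) = A"
  unfolding jacobian_def frechet_derivative_at[OF assms, symmetric]
  by (rule matrix_of_matrix_vector_mul)

section \<open>Calculus of the finite-sum objective\<close>

locale smooth_components =
  fixes f :: "nat \<Rightarrow> real^'d \<Rightarrow> real" and n :: nat and L :: real
  assumes n: "n \<ge> 1" and L: "L > 0"
    and smooth: "\<And>i. i \<in> {1..n} \<Longrightarrow> twice_cont_diff (f i)"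
    and lip: "\<And>i. i \<in> {1..n} \<Longrightarrow> L-lipschitz_on UNIV (grad (f i))"
begin

lemma grad_objective:
  "grad (finite_sum_objective n f) x = (1 / real n) *\<^sub>R (\<Sum>i=1..n. grad (f i) x)"
  and objective_differentiable: "finite_sum_objective n f differentiable (at x)"
proof -
  have "((\<lambda>x. (1 / real n) * (\<Sum>i=1..n. f i x)) has_derivative
      (\<lambda>h. (1 / real n) * (\<Sum>i=1..n. h \<bullet> grad (f i) x))) (at x)"
    by (intro has_derivative_mult_right has_derivative_sum twice_cont_diffD(1) smooth)
  then have "GDERIV (finite_sum_objective n f) x :> (1 / real n) *\<^sub>R (\<Sum>i=1..n. grad (f i) x)"
    by (simp add: gderiv_def finite_sum_objective_def[abs_def] inner_sum_right)
  then show "grad (finite_sum_objective n f) x = (1 / real n) *\<^sub>R (\<Sum>i=1..n. grad (f i) x)"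
    and "finite_sum_objective n f differentiable (at x)"
    by (auto simp: grad_eqI gderiv_def differentiable_def)
qed

lemma grad_objective_has_derivative:
  "(grad (finite_sum_objective n f) has_derivative
    (\<lambda>h. ((1 / real n) *\<^sub>R (\<Sum>i=1..n. hessian (f i) x)) *v h)) (at x)"
proof -
  have "((\<lambda>x. (1 / real n) *\<^sub>R (\<Sum>i=1..n. grad (f i) x)) has_derivative
      (\<lambda>h. (1 / real n) *\<^sub>R (\<Sum>i=1..n. hessian (f i) x *v h))) (at x)"
    by (intro has_derivative_scaleR_right has_derivative_sum twice_cont_diffD(2) smooth)
  then show ?thesis
    by (simp add: grad_objective[abs_def] matrix_vector_mult_sum_left scaleR_matrix_vector_assoc[symmetric])
qed

lemma hessian_objective:
  "hessian (finite_sum_objective n f) x = (1 / real n) *\<^sub>R (\<Sum>i=1..n. hessian (f i) x)"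
  unfolding hessian_def[of "finite_sum_objective n f"]
  by (rule jacobian_eqI[OF grad_objective_has_derivative])

lemma twice_cont_diff_objective: "twice_cont_diff (finite_sum_objective n f)"
  unfolding twice_cont_diff_def
proof (intro conjI allI)
  show "grad (finite_sum_objective n f) differentiable (at x)" for x
    using grad_objective_has_derivative differentiable_def by blast
  have "continuous_on UNIV (\<lambda>x. (1 / real n) *\<^sub>R (\<Sum>i=1..n. hessian (f i) x))"
    using smooth by (intro continuous_intros) (auto simp: twice_cont_diff_def)
  then show "continuous_on UNIV (hessian (finite_sum_objective n f))"
    by (simp add: hessian_objective[abs_def])
qed (rule objective_differentiable)

text \<open>Symmetry of the Hessian allows \<open>lambda_min\<close> to be traded for a negative
  direction; only this form is used from here on.\<close>

lemma strict_saddles_objective: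
  "strict_saddles (finite_sum_objective n f) =
    {x. grad (finite_sum_objective n f) x = 0 \<and>
        (\<exists>v. v \<bullet> (hessian (finite_sum_objective n f) x *v v) < 0)}"
  unfolding strict_saddles_def
  using lambda_min_neg_iff[OF hessian_symmetric[OF twice_cont_diff_objective]] by blast

lemma grad_component_bound:
  "i \<in> {1..n} \<Longrightarrow> norm (grad (f i) x - grad (f i) y) \<le> L * norm (x - y)"
  using lipschitz_onD[OF lip, of i x y] by (simp add: dist_norm)

lemma perm_Suc_mem: "p permutes {1..n} \<Longrightarrow> i < n \<Longrightarrow> p (Suc i) \<in> {1..n}"
  using permutes_in_image[of p "{1..n}" "Suc i"] by simp

section \<open>One epoch with a fixed permutation and step-size\<close>

context
  fixes p :: "nat \<Rightarrow> nat" and s :: real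
  assumes p: "p permutes {1..n}" and s: "0 \<le> s"
begin

text \<open>Each inner step is 2-Lipschitz when \<open>s * L\<close> is at most 1. The crude
  constant is harmless because the number of inner steps is fixed.\<close>

lemma rr_inner_lipschitz:
  assumes sL: "s * L \<le> 1" and "i \<le> n"
  shows "norm (rr_inner f s p x i - rr_inner f s p y i) \<le> 2 ^ i * norm (x - y)"
  using \<open>i \<le> n\<close>
proof (induction i)
  case (Suc i)
  let ?x = "rr_inner f s p x i" and ?y = "rr_inner f s p y i" and ?g = "grad (f (p (Suc i)))"
  have "norm ((?x - ?y) - s *\<^sub>R (?g ?x - ?g ?y)) \<le> norm (?x - ?y) + s * norm (?g ?x - ?g ?y)"
    using norm_triangle_ineq4[of "?x - ?y" "s *\<^sub>R (?g ?x - ?g ?y)"] s by simp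
  also have "s * norm (?g ?x - ?g ?y) \<le> s * (L * norm (?x - ?y))"
    using Suc.prems by (intro mult_left_mono grad_component_bound perm_Suc_mem[OF p] s) auto
  also have "s * (L * norm (?x - ?y)) \<le> 1 * norm (?x - ?y)"
    using mult_right_mono[OF sL norm_ge_zero[of "?x - ?y"]] by (simp add: mult.assoc)
  also have "norm (?x - ?y) + 1 * norm (?x - ?y) \<le> 2 * (2 ^ i * norm (x - y))"
    using Suc by simp
  finally show ?case by (simp add: algebra_simps)
qed simp

text \<open>The gradient term changes a difference by at most a quarter of its length, so each inner
  step retains three quarters of it.\<close>

lemma rr_inner_expanding:
  assumes sL: "s * L \<le> 1 / 4" and "i \<le> n"
  shows "(3 / 4) ^ i * norm (x - y) \<le> norm (rr_inner f s p x i - rr_inner f s p y i)"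
  using \<open>i \<le> n\<close>
proof (induction i)
  case (Suc i)
  let ?x = "rr_inner f s p x i" and ?y = "rr_inner f s p y i" and ?g = "grad (f (p (Suc i)))"
  have "s * norm (?g ?x - ?g ?y) \<le> s * (L * norm (?x - ?y))"
    using Suc.prems by (intro mult_left_mono grad_component_bound perm_Suc_mem[OF p] s) auto
  also have "\<dots> \<le> (1 / 4) * norm (?x - ?y)"
    using mult_right_mono[OF sL norm_ge_zero[of "?x - ?y"]] by (simp add: mult.assoc)
  finally have "(3 / 4) * norm (?x - ?y) \<le> norm (?x - ?y) - s * norm (?g ?x - ?g ?y)" by simp
  also have "\<dots> \<le> norm ((?x - ?y) - s *\<^sub>R (?g ?x - ?g ?y))"
    using norm_triangle_ineq2[of "?x - ?y" "s *\<^sub>R (?g ?x - ?g ?y)"] s by simp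
  finally show ?case using Suc by (simp add: algebra_simps)
qed simp

text \<open>The component gradients need not vanish at \<open>a\<close>, so the distance d to
  \<open>a\<close> only satisfies a recursion d -> 2 d + r. Adding \<open>r\<close> on the left
  makes it homogeneous: d + r at most doubles.\<close>

lemma rr_inner_near:
  assumes sL: "s * L \<le> 1" and G: "\<And>i. i \<in> {1..n} \<Longrightarrow> s * norm (grad (f i) a) \<le> r"
    and x: "norm (x - a) \<le> r" and "i \<le> n"
  shows "norm (rr_inner f s p x i - a) + r \<le> 2 ^ i * (2 * r)"
  using \<open>i \<le> n\<close>
proof (induction i)
  case (Suc i)
  let ?x = "rr_inner f s p x i" and ?g = "grad (f (p (Suc i)))"
  have mem: "p (Suc i) \<in> {1..n}" using Suc.prems by (intro perm_Suc_mem[OF p]) auto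
  have "s * norm (?g ?x - ?g a) \<le> s * (L * norm (?x - a))"
    by (intro mult_left_mono grad_component_bound mem s)
  also have "\<dots> \<le> norm (?x - a)"
    using mult_right_mono[OF sL norm_ge_zero[of "?x - a"]] by (simp add: mult.assoc)
  finally have 1: "norm (s *\<^sub>R (?g ?x - ?g a)) \<le> norm (?x - a)" using s by simp
  have 2: "norm (s *\<^sub>R ?g a) \<le> r" using G[OF mem] s by simp
  have "?x - s *\<^sub>R ?g ?x - a = (?x - a) - s *\<^sub>R (?g ?x - ?g a) - s *\<^sub>R ?g a"
    by (simp add: algebra_simps)
  then have "norm (?x - s *\<^sub>R ?g ?x - a) \<le>
      norm (?x - a) + norm (s *\<^sub>R (?g ?x - ?g a)) + norm (s *\<^sub>R ?g a)"
    by (metis norm_triangle_ineq4 norm_triangle_le_diff add_right_mono)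
  then show ?case using Suc 1 2 by simp
qed (use x in simp)

text \<open>Within an epoch the difference of two orbits moves only by order \<open>s\<close>. This
  lets the linearization apply every Hessian to the initial difference at a second-order
  cost.\<close>

lemma rr_inner_displacement:
  assumes sL: "s * L \<le> 1" and "i \<le> n"
  shows "norm (rr_inner f s p x i - rr_inner f s p y i - (x - y)) \<le> real i * (s * L * 2 ^ n * norm (x - y))"
  using \<open>i \<le> n\<close>
proof (induction i)
  case (Suc i)
  let ?x = "rr_inner f s p x i" and ?y = "rr_inner f s p y i" and ?g = "grad (f (p (Suc i)))"
  have "s * norm (?g ?x - ?g ?y) \<le> s * (L * norm (?x - ?y))"
    using Suc.prems by (intro mult_left_mono grad_component_bound perm_Suc_mem[OF p] s) auto
  also have "\<dots> \<le> s * (L * (2 ^ i * norm (x - y)))"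
    using Suc.prems s L by (intro mult_left_mono rr_inner_lipschitz sL) auto
  also have "\<dots> \<le> s * (L * (2 ^ n * norm (x - y)))"
    using Suc.prems s L by (intro mult_left_mono mult_right_mono power_increasing) auto
  finally have 1: "norm (s *\<^sub>R (?g ?x - ?g ?y)) \<le> s * L * 2 ^ n * norm (x - y)"
    using s by (simp add: mult.assoc)
  have "rr_inner f s p x (Suc i) - rr_inner f s p y (Suc i) - (x - y)
      = (?x - ?y - (x - y)) - s *\<^sub>R (?g ?x - ?g ?y)"
    by (simp add: algebra_simps)
  then have "norm (rr_inner f s p x (Suc i) - rr_inner f s p y (Suc i) - (x - y))
      \<le> norm (?x - ?y - (x - y)) + norm (s *\<^sub>R (?g ?x - ?g ?y))"
    by (metis norm_triangle_ineq4)
  also have "\<dots> \<le> real i * (s * L * 2 ^ n * norm (x - y)) + s * L * 2 ^ n * norm (x - y)"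
    using Suc 1 by (intro add_mono) auto
  finally show ?case by (simp add: algebra_simps)
qed simp

text \<open>To first order in \<open>s\<close>, the product of the factors I - s H is I minus
  \<open>s\<close> times the sum of the H. The error has a part from strict differentiability,
  governed by \<delta>, and a part of second order in \<open>s\<close>.\<close>

lemma rr_inner_linearization:
  assumes sL: "s * L \<le> 1" and C: "0 \<le> C" "\<And>i w. i \<in> {1..n} \<Longrightarrow> norm (H i *v w) \<le> C * norm w"
    and \<delta>: "0 \<le> \<delta>"
    and strict: "\<And>i u w. i \<in> {1..n} \<Longrightarrow> u \<in> U \<Longrightarrow> w \<in> U \<Longrightarrow>
        norm (grad (f i) u - grad (f i) w - H i *v (u - w)) \<le> \<delta> * norm (u - w)"
    and U: "\<And>i. i \<le> n \<Longrightarrow> rr_inner f s p x i \<in> U" "\<And>i. i \<le> n \<Longrightarrow> rr_inner f s p y i \<in> U"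
    and "i \<le> n"
  shows "norm (rr_inner f s p x i - rr_inner f s p y i
          - (x - y - s *\<^sub>R (\<Sum>j=1..i. H (p j) *v (x - y))))
    \<le> real i * (s * (2 ^ n * (\<delta> + real n * C * L * s) * norm (x - y)))"
  using \<open>i \<le> n\<close>
proof (induction i)
  case (Suc i)
  let ?x = "rr_inner f s p x i" and ?y = "rr_inner f s p y i" and ?g = "grad (f (p (Suc i)))"
  let ?H = "H (p (Suc i))" and ?z = "x - y"
  let ?T = "\<lambda>i. ?z - s *\<^sub>R (\<Sum>j=1..i. H (p j) *v ?z)"
  have mem: "p (Suc i) \<in> {1..n}" using Suc.prems by (intro perm_Suc_mem[OF p]) auto
  have "norm (?g ?x - ?g ?y - ?H *v (?x - ?y)) \<le> \<delta> * norm (?x - ?y)"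
    using Suc.prems by (intro strict mem U) auto
  also have "\<dots> \<le> \<delta> * (2 ^ i * norm ?z)"
    using Suc.prems \<delta> by (intro mult_left_mono rr_inner_lipschitz sL) auto
  also have "\<dots> \<le> \<delta> * (2 ^ n * norm ?z)"
    using Suc.prems \<delta> by (intro mult_left_mono mult_right_mono power_increasing) auto
  finally have 1: "norm (?g ?x - ?g ?y - ?H *v (?x - ?y)) \<le> \<delta> * (2 ^ n * norm ?z)" .
  have "norm (?H *v (?x - ?y - ?z)) \<le> C * norm (?x - ?y - ?z)" by (rule C(2)[OF mem])
  also have "\<dots> \<le> C * (real i * (s * L * 2 ^ n * norm ?z))"
    using Suc.prems C by (intro mult_left_mono rr_inner_displacement sL) auto
  also have "\<dots> \<le> C * (real n * (s * L * 2 ^ n * norm ?z))"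
    using Suc.prems C s L by (intro mult_left_mono mult_right_mono) auto
  finally have 2: "norm (?H *v (?x - ?y - ?z)) \<le> C * (real n * (s * L * 2 ^ n * norm ?z))" .
  \<comment> \<open>The first summand is the strict-derivative error at the current inner iterates,
    the second the cost of replacing their difference by the initial one.\<close>
  have "?g ?x - ?g ?y - ?H *v ?z = (?g ?x - ?g ?y - ?H *v (?x - ?y)) + ?H *v (?x - ?y - ?z)"
    by (simp add: matrix_vector_mult_diff_distrib)
  then have "norm (?g ?x - ?g ?y - ?H *v ?z) \<le> norm (?g ?x - ?g ?y - ?H *v (?x - ?y)) + norm (?H *v (?x - ?y - ?z))"
    by (metis norm_triangle_ineq)
  also have "\<dots> \<le> \<delta> * (2 ^ n * norm ?z) + C * (real n * (s * L * 2 ^ n * norm ?z))"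
    by (intro add_mono 1 2)
  finally have "norm (?g ?x - ?g ?y - ?H *v ?z) \<le> 2 ^ n * (\<delta> + real n * C * L * s) * norm ?z"
    by (simp add: algebra_simps)
  then have 3: "norm (s *\<^sub>R (?g ?x - ?g ?y - ?H *v ?z)) \<le> s * (2 ^ n * (\<delta> + real n * C * L * s) * norm ?z)"
    using s by (simp add: mult_left_mono)
  have "rr_inner f s p x (Suc i) - rr_inner f s p y (Suc i) - ?T (Suc i)
      = (?x - ?y - ?T i) - s *\<^sub>R (?g ?x - ?g ?y - ?H *v ?z)"
    by (simp add: scaleR_add_right scaleR_diff_right)
  then have "norm (rr_inner f s p x (Suc i) - rr_inner f s p y (Suc i) - ?T (Suc i))
      \<le> norm (?x - ?y - ?T i) + norm (s *\<^sub>R (?g ?x - ?g ?y - ?H *v ?z))"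
    by (metis norm_triangle_ineq4)
  also have "\<dots> \<le> real i * (s * (2 ^ n * (\<delta> + real n * C * L * s) * norm ?z))
      + s * (2 ^ n * (\<delta> + real n * C * L * s) * norm ?z)"
    using Suc by (intro add_mono 3) auto
  also have "\<dots> = real (Suc i) * (s * (2 ^ n * (\<delta> + real n * C * L * s) * norm ?z))"
    by (simp add: distrib_right)
  finally show ?case .
qed simp

end


text \<open>Over a full epoch the Hessians sum to the same matrix for every permutation, so all
  epochs near \<open>a\<close> share one linear part, uniformly in \<open>q\<close>.\<close>

lemma rr_step_linearization:
  assumes \<delta>: "\<delta> > 0"
  obtains r h where "r > 0" "h > 0"
    "\<forall>s q x y. 0 < s \<longrightarrow> s \<le> h \<longrightarrow> s * L \<le> 1 \<longrightarrow> q permutes {1..n} \<longrightarrow> x \<in> ball a r \<longrightarrow> y \<in> ball a r \<longrightarrow>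
       norm (rr_inner f s q x n - rr_inner f s q y n
             - ((x - y) - s *\<^sub>R ((\<Sum>i=1..n. hessian (f i) a) *v (x - y)))) \<le> s * \<delta> * norm (x - y)"
proof -
  define H where "H i = hessian (f i) a" for i
  have "\<forall>i. \<exists>C>0. \<forall>w. norm (H i *v w) \<le> C * norm w"
    by (metis norm_matrix_vector_bound)
  then obtain c where c: "\<And>i. c i > 0" "\<And>i w. norm (H i *v w) \<le> c i * norm w" by metis
  define C where "C = (\<Sum>i=1..n. c i)"
  have C: "norm (H i *v w) \<le> C * norm w" if "i \<in> {1..n}" for i w
  proof -
    have "c i \<le> C" unfolding C_def using that c(1) by (intro member_le_sum) (auto simp: less_imp_le)
    then show ?thesis using c(2)[of i w] mult_right_mono[of "c i" C "norm w"] by simp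
  qed
  have C0: "C > 0" unfolding C_def using n c(1) by (intro sum_pos) auto
  \<comment> \<open>Accumulated over the \<open>n\<close> inner steps, the strict-derivative error
    then amounts to \<delta> / 2.\<close>
  define \<delta>' where "\<delta>' = \<delta> / (2 * real n * 2 ^ n)"
  have \<delta>': "\<delta>' > 0" using \<delta> n by (simp add: \<delta>'_def)
  have "\<exists>\<rho>>0. \<forall>u\<in>ball a \<rho>. \<forall>w\<in>ball a \<rho>.
      norm (grad (f i) u - grad (f i) w - H i *v (u - w)) \<le> \<delta>' * norm (u - w)" if "i \<in> {1..n}" for i
    unfolding H_def
    using strict_derivative_matrix[OF twice_cont_diffD(2,3)[OF smooth[OF that]] \<delta>', of a] by metis
  then obtain R where R: "\<And>i. i \<in> {1..n} \<Longrightarrow> R i > 0"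
    "\<And>i u w. i \<in> {1..n} \<Longrightarrow> u \<in> ball a (R i) \<Longrightarrow> w \<in> ball a (R i) \<Longrightarrow>
      norm (grad (f i) u - grad (f i) w - H i *v (u - w)) \<le> \<delta>' * norm (u - w)"
    by metis
  define \<rho> where "\<rho> = Min (R ` {1..n})"
  have \<rho>: "\<rho> > 0" using R(1) n by (simp add: \<rho>_def)
  have \<rho>R: "\<rho> \<le> R i" if "i \<in> {1..n}" for i using that by (simp add: \<rho>_def)
  \<comment> \<open>Inner iterates starting in this ball drift at most by the factor in
    \<open>rr_inner_near\<close>, so they stay in the ball of radius \<rho>, where strict
    differentiability holds for all components.\<close>
  define r where "r = \<rho> / (2 * 2 ^ n)"
  have r: "r > 0" using \<rho> by (simp add: r_def)
  define G where "G = (\<Sum>i=1..n. norm (grad (f i) a))"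
  have G: "norm (grad (f i) a) \<le> G" if "i \<in> {1..n}" for i
    unfolding G_def using that by (intro member_le_sum) auto
  have G0: "G \<ge> 0" unfolding G_def by (intro sum_nonneg) simp
  define D where "D = real n * real n * C * L * 2 ^ n"
  have D: "D > 0" using n C0 L by (simp add: D_def)
  \<comment> \<open>The first bound limits the drift caused by the gradients at \<open>a\<close> to
    \<open>r\<close> per inner step; the second brings the second-order error below the other
    \<delta> / 2.\<close>
  define h where "h = min (r / (G + 1)) (\<delta> / (2 * D))"
  have h: "h > 0" using r G0 \<delta> D by (simp add: h_def)
  show thesis
  proof (rule that[OF r h])
    show "\<forall>s q x y. 0 < s \<longrightarrow> s \<le> h \<longrightarrow> s * L \<le> 1 \<longrightarrow> q permutes {1..n} \<longrightarrow> x \<in> ball a r \<longrightarrow> y \<in> ball a r \<longrightarrow>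
         norm (rr_inner f s q x n - rr_inner f s q y n
               - ((x - y) - s *\<^sub>R ((\<Sum>i=1..n. hessian (f i) a) *v (x - y)))) \<le> s * \<delta> * norm (x - y)"
    proof (intro allI impI)
      fix s q x y
      assume s: "0 < s" "s \<le> h" "s * L \<le> 1" and q: "q permutes {1..n}"
        and xy: "x \<in> ball a r" "y \<in> ball a r"
      show "norm (rr_inner f s q x n - rr_inner f s q y n
          - ((x - y) - s *\<^sub>R ((\<Sum>i=1..n. hessian (f i) a) *v (x - y)))) \<le> s * \<delta> * norm (x - y)"
      proof -
        have sG: "s * norm (grad (f i) a) \<le> r" if "i \<in> {1..n}" for i
        proof -
          have "s * norm (grad (f i) a) \<le> (r / (G + 1)) * (G + 1)"
            using s G[OF that] r G0 by (intro mult_mono) (auto simp: h_def)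
          then show ?thesis using G0 by simp
        qed
        have near: "rr_inner f s q u i \<in> ball a \<rho>" if "u \<in> ball a r" "i \<le> n" for u i
        proof -
          have "norm (rr_inner f s q u i - a) + r \<le> 2 ^ i * (2 * r)"
            using that s by (intro rr_inner_near q sG) (auto simp: dist_norm norm_minus_commute)
          also have "\<dots> \<le> 2 ^ n * (2 * r)"
            using that r by (intro mult_right_mono power_increasing) auto
          also have "\<dots> = \<rho>" by (simp add: r_def)
          finally show ?thesis using r by (simp add: dist_norm norm_minus_commute)
        qed
        have strict: "norm (grad (f i) u - grad (f i) w - H i *v (u - w)) \<le> \<delta>' * norm (u - w)"
          if "i \<in> {1..n}" "u \<in> ball a \<rho>" "w \<in> ball a \<rho>" for i u w
          using that \<rho>R[OF that(1)] by (intro R(2)) auto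
        have "norm (rr_inner f s q x n - rr_inner f s q y n
              - (x - y - s *\<^sub>R (\<Sum>j=1..n. H (q j) *v (x - y))))
            \<le> real n * (s * (2 ^ n * (\<delta>' + real n * C * L * s) * norm (x - y)))"
          using s C0 \<delta>' by (intro rr_inner_linearization[where U = "ball a \<rho>"] q C strict near xy) auto
        also have "(\<Sum>j=1..n. H (q j) *v (x - y)) = (\<Sum>j=1..n. H j *v (x - y))"
          by (rule sum.permute[OF q, of "\<lambda>j. H j *v (x - y)", unfolded comp_def, symmetric])
        also have "\<dots> = (\<Sum>i=1..n. hessian (f i) a) *v (x - y)"
          by (simp add: matrix_vector_mult_sum_left H_def)
        also have "real n * (s * (2 ^ n * (\<delta>' + real n * C * L * s) * norm (x - y)))
            = s * (real n * 2 ^ n * \<delta>' + D * s) * norm (x - y)"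
          by (simp add: D_def algebra_simps)
        also have "\<dots> \<le> s * (\<delta> / 2 + \<delta> / 2) * norm (x - y)"
        proof (intro mult_right_mono mult_left_mono add_mono)
          show "real n * 2 ^ n * \<delta>' \<le> \<delta> / 2" using n by (simp add: \<delta>'_def)
          have "s \<le> \<delta> / (2 * D)" using s by (simp add: h_def)
          then show "D * s \<le> \<delta> / 2" using D by (simp add: field_simps)
        qed (use s in auto)
        finally show ?thesis by simp
      qed
    qed
  qed
qed

section \<open>Orbits under a fixed sequence of permutations\<close>

context
  fixes \<eta> :: "nat \<Rightarrow> real" and p :: "nat \<Rightarrow> nat \<Rightarrow> nat"
  assumes \<eta>: "\<And>k. 0 < \<eta> k \<and> \<eta> k * L \<le> 1 / 4"
    and p: "\<And>k. p k permutes {1..n}"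
begin

lemma rr_iter_expanding:
  "((3 / 4) ^ n) ^ k * norm (x - y) \<le> norm (rr_iter n f \<eta> p x k - rr_iter n f \<eta> p y k)"
proof (induction k)
  case (Suc k)
  let ?x = "rr_iter n f \<eta> p x k" and ?y = "rr_iter n f \<eta> p y k"
  have "(3 / 4) ^ n * (((3 / 4) ^ n) ^ k * norm (x - y)) \<le> (3 / 4) ^ n * norm (?x - ?y)"
    by (intro mult_left_mono Suc) simp
  also have "\<dots> \<le> norm (rr_inner f (\<eta> k) (p k) ?x n - rr_inner f (\<eta> k) (p k) ?y n)"
    using \<eta>[of k] by (intro rr_inner_expanding p) auto
  finally show ?case by simp
qed simp

text \<open>Two trapped orbits have a bounded difference, which follows the perturbed linear
  recursion once the step-sizes are small; hence the threshold \<open>m0\<close>. The cone condition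
  is obtained at epoch \<open>m\<close> and carried back to epoch 0 by expansion.\<close>

lemma negligible_trapped_near_saddle:
  assumes lim: "\<eta> \<longlonglongrightarrow> 0" and div: "\<not> summable \<eta>"
    and neg: "v \<bullet> (hessian (finite_sum_objective n f) a *v v) < 0"
  shows "\<exists>r>0. \<exists>m0. \<forall>m\<ge>m0. negligible {x. \<forall>k\<ge>m. rr_iter n f \<eta> p x k \<in> ball a r}"
proof -
  define A where "A = (\<Sum>i=1..n. hessian (f i) a)"
  have symA: "(A *v x) \<bullet> y = x \<bullet> (A *v y)" for x y
    unfolding A_def matrix_vector_mult_sum_left inner_sum_left inner_sum_right
    by (intro sum.cong refl hessian_symmetric smooth)
  have "hessian (finite_sum_objective n f) a = (1 / real n) *\<^sub>R A"
    by (simp add: hessian_objective A_def)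
  then have negA: "v \<bullet> (A *v v) < 0"
    using neg n by (simp add: scaleR_matrix_vector_assoc[symmetric] divide_less_0_iff)
  obtain B :: "real^'d^'d" and \<delta> h0 :: real where \<delta>: "\<delta> > 0" and h0: "h0 > 0"
    and negB: "v \<bullet> (B *v v) < 0"
    and cone: "\<forall>(z :: nat \<Rightarrow> real^'d) h.
       (\<forall>k. 0 < h k \<and> h k \<le> h0) \<longrightarrow> \<not> summable h \<longrightarrow> bounded (range z) \<longrightarrow> z 0 \<noteq> 0 \<longrightarrow>
       (\<forall>k. norm (z (Suc k) - (z k - h k *\<^sub>R (A *v z k))) \<le> h k * \<delta> * norm (z k)) \<longrightarrow>
       0 < z 0 \<bullet> (B *v z 0)"
    by (rule bounded_perturbed_orbits_in_cone[OF symA negA])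
  obtain r h1 where r: "r > 0" and h1: "h1 > 0" and lin:
    "\<forall>s q x y. 0 < s \<longrightarrow> s \<le> h1 \<longrightarrow> s * L \<le> 1 \<longrightarrow> q permutes {1..n} \<longrightarrow> x \<in> ball a r \<longrightarrow> y \<in> ball a r \<longrightarrow>
       norm (rr_inner f s q x n - rr_inner f s q y n
             - ((x - y) - s *\<^sub>R (A *v (x - y)))) \<le> s * \<delta> * norm (x - y)"
    by (rule rr_step_linearization[OF \<delta>, of a, folded A_def])
  have "\<forall>\<^sub>F k in sequentially. \<eta> k < min h0 h1"
    using lim h0 h1 by (intro order_tendstoD) auto
  then obtain m0 where m0: "\<And>k. k \<ge> m0 \<Longrightarrow> \<eta> k < min h0 h1"
    by (auto simp: eventually_sequentially)
  have "negligible {x. \<forall>k\<ge>m. rr_iter n f \<eta> p x k \<in> ball a r}" if m: "m \<ge> m0" for m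
  proof -
    let ?S = "{x. \<forall>k\<ge>m. rr_iter n f \<eta> p x k \<in> ball a r}"
    let ?X = "\<lambda>x k. rr_iter n f \<eta> p x k"
    have exp: "((3 / 4) ^ n) ^ m * norm (x - y) \<le> norm (?X x m - ?X y m)" for x y
      by (rule rr_iter_expanding)
    have "negligible ((\<lambda>x. ?X x m) ` ?S)"
    proof (rule negligible_if_differences_in_cone[OF negB])
      fix x' y' assume "x' \<in> (\<lambda>x. ?X x m) ` ?S" "y' \<in> (\<lambda>x. ?X x m) ` ?S" and ne: "x' \<noteq> y'"
      then obtain x y where x: "x \<in> ?S" "x' = ?X x m" and y: "y \<in> ?S" "y' = ?X y m" by blast
      \<comment> \<open>The recursion is restarted at epoch \<open>m\<close>, so that
        \<open>z 0\<close> is the difference of the two points in question; a shifted divergent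
        series still diverges.\<close>
      define z where "z k = ?X x (m + k) - ?X y (m + k)" for k
      define h where "h k = \<eta> (m + k)" for k
      have "0 < z 0 \<bullet> (B *v z 0)"
      proof (rule cone[rule_format])
        show "0 < h k \<and> h k \<le> h0" for k
          using \<eta>[of "m + k"] m0[of "m + k"] m by (auto simp: h_def)
        show "\<not> summable h"
          using div summable_iff_shift[of \<eta> m] by (simp add: h_def[abs_def] add.commute)
        have "norm (z k) \<le> 2 * r" for k
        proof -
          have "dist a (?X x (m + k)) < r" "dist a (?X y (m + k)) < r" using x(1) y(1) by auto
          then show ?thesis
            using dist_triangle3[of "?X x (m + k)" "?X y (m + k)" a] by (simp add: z_def dist_norm)
        qed
        then show "bounded (range z)" by (auto simp: bounded_iff)
        show "z 0 \<noteq> 0" using ne x y by (simp add: z_def)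
        show "norm (z (Suc k) - (z k - h k *\<^sub>R (A *v z k))) \<le> h k * \<delta> * norm (z k)" for k
          unfolding z_def h_def add_Suc_right rr_iter.simps
          using \<eta>[of "m + k"] m0[of "m + k"] m x(1) y(1) by (intro lin[rule_format] p) auto
      qed
      then show "0 < (x' - y') \<bullet> (B *v (x' - y'))" by (simp add: z_def x y)
    qed
    then show ?thesis
      by (rule negligible_if_expanding_image[where T = "\<lambda>x. ?X x m", OF _ exp, rotated]) simp
  qed
  then show ?thesis using r by blast
qed

lemma negligible_limit_strict_saddle:
  assumes lim: "\<eta> \<longlonglongrightarrow> 0" and div: "\<not> summable \<eta>"
  shows "negligible {x. \<exists>l\<in>strict_saddles (finite_sum_objective n f). rr_iter n f \<eta> p x \<longlonglongrightarrow> l}"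
proof -
  let ?SS = "strict_saddles (finite_sum_objective n f)"
  define N where "N a r m = {x. \<forall>k\<ge>m. rr_iter n f \<eta> p x k \<in> ball a r}" for a r m
  have "\<exists>r>0. \<exists>m0. \<forall>m\<ge>m0. negligible (N a r m)" if "a \<in> ?SS" for a
  proof -
    obtain v where "v \<bullet> (hessian (finite_sum_objective n f) a *v v) < 0"
      using \<open>a \<in> ?SS\<close> unfolding strict_saddles_objective by blast
    from negligible_trapped_near_saddle[OF lim div this] show ?thesis by (simp add: N_def)
  qed
  then obtain r m0 where r: "\<And>a. a \<in> ?SS \<Longrightarrow> r a > 0"
    and neg: "\<And>a m. a \<in> ?SS \<Longrightarrow> m \<ge> m0 a \<Longrightarrow> negligible (N a (r a) m)"
    by metis
  \<comment> \<open>There may be uncountably many saddles, but countably many of their trapping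
    balls cover them all.\<close>
  obtain \<F> where \<F>: "\<F> \<subseteq> (\<lambda>a. ball a (r a)) ` ?SS" "countable \<F>"
      "\<Union>\<F> = \<Union>((\<lambda>a. ball a (r a)) ` ?SS)"
    by (rule Lindelof[of "(\<lambda>a. ball a (r a)) ` ?SS"]) auto
  then obtain T where T: "countable T" "T \<subseteq> ?SS" "\<F> = (\<lambda>a. ball a (r a)) ` T"
    using countable_subset_image[of \<F>] by metis
  let ?I = "Sigma T (\<lambda>a. {m0 a..})"
  have "negligible (\<Union>((\<lambda>(a, m). N a (r a) m) ` ?I))"
  proof (rule negligible_countable_Union)
    show "countable ((\<lambda>(a, m). N a (r a) m) ` ?I)"
      using T(1) by (intro countable_image countable_SIGMA) auto
  qed (use neg T(2) in auto)
  then show ?thesis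
  proof (rule negligible_subset, safe)
    fix x l assume l: "l \<in> ?SS" and conv: "rr_iter n f \<eta> p x \<longlonglongrightarrow> l"
    have "l \<in> \<Union>\<F>" using l r \<F>(3) by force
    then obtain a where a: "a \<in> T" "l \<in> ball a (r a)" using T(3) by blast
    have "\<forall>\<^sub>F k in sequentially. rr_iter n f \<eta> p x k \<in> ball a (r a)"
      using topological_tendstoD[OF conv open_ball a(2)] .
    then obtain K where K: "\<And>k. k \<ge> K \<Longrightarrow> rr_iter n f \<eta> p x k \<in> ball a (r a)"
      by (auto simp: eventually_sequentially)
    \<comment> \<open>The centre \<open>a\<close> need not be the limit \<open>l\<close>. The
      maximum ensures both that the orbit is already trapped and that the trapping set is known to
      be null.\<close>
    have "x \<in> N a (r a) (max K (m0 a))" using K by (auto simp: N_def)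
    moreover have "(a, max K (m0 a)) \<in> ?I" using a by auto
    ultimately show "x \<in> \<Union>((\<lambda>(a, m). N a (r a) m) ` ?I)" by blast
  qed
qed

end

end

section \<open>Measurability and independence\<close>

text \<open>Independence is the product formula on measurable rectangles, which determines the joint
  law as the product of the marginals; this is what makes Fubini available.\<close>

lemma (in prob_space) indep_rv_distr:
  assumes "indep_rv S X T Y"
  shows "distr M S X \<Otimes>\<^sub>M distr M T Y = distr M (S \<Otimes>\<^sub>M T) (\<lambda>\<omega>. (X \<omega>, Y \<omega>))"
proof -
  have X[measurable]: "X \<in> measurable M S" and Y[measurable]: "Y \<in> measurable M T"
    and ind: "indep_set {X -` A \<inter> space M | A. A \<in> sets S} {Y -` B \<inter> space M | B. B \<in> sets T}"
    using assms by (auto simp: indep_rv_def)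
  interpret X: prob_space "distr M S X" by (rule prob_space_distr[OF X])
  interpret Y: prob_space "distr M T Y" by (rule prob_space_distr[OF Y])
  show ?thesis
  proof (rule pair_measure_eqI)
    fix A B assume "A \<in> sets (distr M S X)" "B \<in> sets (distr M T Y)"
    then have A[measurable]: "A \<in> sets S" and B[measurable]: "B \<in> sets T" by auto
    have "prob ((X -` A \<inter> space M) \<inter> (Y -` B \<inter> space M))
        = prob (X -` A \<inter> space M) * prob (Y -` B \<inter> space M)"
      using A B by (intro indep_setD[OF ind]) auto
    moreover have "(\<lambda>\<omega>. (X \<omega>, Y \<omega>)) -` (A \<times> B) \<inter> space M
        = (X -` A \<inter> space M) \<inter> (Y -` B \<inter> space M)" by auto
    ultimately show "emeasure (distr M S X) A * emeasure (distr M T Y) B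
        = emeasure (distr M (S \<Otimes>\<^sub>M T) (\<lambda>\<omega>. (X \<omega>, Y \<omega>))) (A \<times> B)"
      by (simp add: emeasure_distr emeasure_eq_measure ennreal_mult)
  next
    show "sets (distr M S X \<Otimes>\<^sub>M distr M T Y) = sets (distr M (S \<Otimes>\<^sub>M T) (\<lambda>\<omega>. (X \<omega>, Y \<omega>)))"
      unfolding sets_distr by (intro sets_pair_measure_cong sets_distr)
  qed (rule X.sigma_finite_measure_axioms Y.sigma_finite_measure_axioms)+
qed

text \<open>The existential over limits is uncountable. Completeness replaces it by the Cauchy
  property together with membership of \<open>lim\<close> in \<open>S\<close>, and both are
  measurable.\<close>

lemma sets_Collect_tendsto_in:
  fixes X :: "nat \<Rightarrow> 'a \<Rightarrow> 'b::{banach, second_countable_topology}"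
  assumes X[measurable]: "\<And>k. X k \<in> borel_measurable N" and S[measurable]: "S \<in> sets borel"
  shows "{\<omega> \<in> space N. \<exists>l\<in>S. (\<lambda>k. X k \<omega>) \<longlonglongrightarrow> l} \<in> sets N"
proof -
  have "{\<omega> \<in> space N. \<exists>l\<in>S. (\<lambda>k. X k \<omega>) \<longlonglongrightarrow> l}
      = {\<omega> \<in> space N. Cauchy (\<lambda>k. X k \<omega>) \<and> lim (\<lambda>k. X k \<omega>) \<in> S}"
    by (auto simp: Cauchy_convergent_iff convergent_def dest: limI)
  also have "\<dots> \<in> sets N" by measurable
  finally show ?thesis .
qed

section \<open>Measurability of the iterates and of the strict saddles\<close>

context smooth_components
begin

lemma rr_inner_measurable:
  assumes P: "P \<in> measurable N (perm_space n)" and X: "X \<in> borel_measurable N" and "i \<le> n"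
  shows "(\<lambda>\<omega>. rr_inner f s (P \<omega>) (X \<omega>) i) \<in> borel_measurable N"
  using \<open>i \<le> n\<close>
proof (induction i)
  case (Suc i)
  let ?Y = "\<lambda>\<omega>. rr_inner f s (P \<omega>) (X \<omega>) i"
  have Y[measurable]: "?Y \<in> borel_measurable N" using Suc by simp
  \<comment> \<open>The component index is random but takes its value from one of finitely many
    permutations, so measurability can be checked with the permutation frozen.\<close>
  have [measurable]: "(\<lambda>\<omega>. grad (f (P \<omega> (Suc i))) (?Y \<omega>)) \<in> borel_measurable N"
  proof (rule measurable_compose_countable'[where f = "\<lambda>q \<omega>. grad (f (q (Suc i))) (?Y \<omega>)"
        and I = "{q. q permutes {1..n}}" and g = P])
    fix q assume "q \<in> {q. q permutes {1..n}}"
    then have "q (Suc i) \<in> {1..n}" using perm_Suc_mem[of q i] Suc.prems by simp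
    then have "grad (f (q (Suc i))) \<in> borel_measurable borel"
      by (intro borel_measurable_continuous_onI lipschitz_on_continuous_on[OF lip])
    then show "(\<lambda>\<omega>. grad (f (q (Suc i))) (?Y \<omega>)) \<in> borel_measurable N"
      by (rule measurable_compose[OF Y])
  next
    show "P \<in> measurable N (count_space {q. q permutes {1..n}})"
      using P by (simp add: perm_space_def)
    show "countable {q. q permutes {1..n}}"
      by (intro countable_finite finite_permutations) simp
  qed
  show ?case by simp
qed (simp add: X)

lemma rr_iter_measurable:
  assumes P: "\<And>k. (\<lambda>\<omega>. P \<omega> k) \<in> measurable N (perm_space n)" and X: "X \<in> borel_measurable N"
  shows "(\<lambda>\<omega>. rr_iter n f \<eta> (P \<omega>) (X \<omega>) k) \<in> borel_measurable N"
proof (induction k)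
  case (Suc k)
  then show ?case by (simp add: rr_inner_measurable[OF P])
qed (simp add: X)

text \<open>The critical points form a closed set, and the points with some negative direction form
  an open one, being a union of open sets over all \<open>v\<close>.\<close>

lemma strict_saddles_borel: "strict_saddles (finite_sum_objective n f) \<in> sets borel"
proof -
  let ?F = "finite_sum_objective n f"
  have "continuous_on UNIV (grad ?F)"
    by (intro continuous_at_imp_continuous_on ballI
        has_derivative_continuous[OF twice_cont_diffD(2)[OF twice_cont_diff_objective]])
  then have cl: "closed {x. grad ?F x = 0}" by (intro closed_Collect_eq continuous_intros)
  have cont: "continuous_on UNIV (\<lambda>x. v \<bullet> (hessian ?F x *v v))" for v
  proof -
    have "continuous_on UNIV (hessian ?F)"
      using twice_cont_diff_objective by (simp add: twice_cont_diff_def)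
    then show ?thesis
      unfolding matrix_vector_mult_def by (intro continuous_intros)
  qed
  have "open {x. v \<bullet> (hessian ?F x *v v) < 0}" for v
    by (rule open_Collect_less[OF cont continuous_on_const])
  then have op: "open (\<Union>v. {x. v \<bullet> (hessian ?F x *v v) < 0})" by (intro open_UN ballI)
  have "strict_saddles ?F = {x. grad ?F x = 0} \<inter> (\<Union>v. {x. v \<bullet> (hessian ?F x *v v) < 0})"
    by (auto simp: strict_saddles_objective)
  then show ?thesis
    using sets.Int[OF borel_closed[OF cl] borel_open[OF op]] by (simp only:)
qed

end

theorem corollary5p3:
  fixes f :: "nat \<Rightarrow> real^'d \<Rightarrow> real"
    and n :: nat
    and L :: real
    and \<eta> :: "nat \<Rightarrow> real"
    and M :: "'a measure"
    and X0 :: "'a \<Rightarrow> real^'d"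
    and g :: "real^'d \<Rightarrow> ennreal"
    and \<pi> :: "nat \<Rightarrow> 'a \<Rightarrow> nat \<Rightarrow> nat"
  assumes "n \<ge> 1"
    and "L > 0"
    and "\<And>i. i \<in> {1..n} \<Longrightarrow> twice_cont_diff (f i)"
    and "\<And>i. i \<in> {1..n} \<Longrightarrow> L-lipschitz_on UNIV (grad (f i))"
    and "\<And>i. i \<in> {1..n} \<Longrightarrow> locally_lipschitz (hessian (f i))"
    and "\<And>k. 0 < \<eta> k \<and> \<eta> k \<le> 1 / (4 * real n * L)"
    and "filterlim (\<lambda>N. \<Sum>k<N. \<eta> k) at_top sequentially"
    and "summable (\<lambda>k. (\<eta> k)\<^sup>2)"
    and "prob_space M"
    and "distributed M lborel X0 g"
    and "\<And>k. \<pi> k \<in> measurable M (perm_space n)"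
    and "prob_space.indep_rv M borel X0
           (\<Pi>\<^sub>M k\<in>UNIV. perm_space n) (\<lambda>\<omega> k. \<pi> k \<omega>)"
  defines "E \<equiv> {\<omega> \<in> space M. \<exists>l \<in> strict_saddles (finite_sum_objective n f).
                   (\<lambda>k. rr_iter n f \<eta> (\<lambda>j. \<pi> j \<omega>) (X0 \<omega>) k) \<longlonglongrightarrow> l}"
  shows "E \<in> sets M \<and> measure M E = 0"
proof -
  interpret prob_space M by fact
  interpret smooth_components f n L by (rule smooth_components.intro[OF assms(1-4)])
  let ?SS = "strict_saddles (finite_sum_objective n f)"
  let ?P = "\<Pi>\<^sub>M k\<in>(UNIV::nat set). perm_space n"
  define perms where "perms \<omega> = (\<lambda>k. \<pi> k \<omega>)" for \<omega>
  have X0: "X0 \<in> borel_measurable M" and perms: "perms \<in> measurable M ?P" and ind: "indep_rv borel X0 ?P perms"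
    using assms(12) by (auto simp: indep_rv_def perms_def[abs_def])
  have \<eta>: "0 < \<eta> k \<and> \<eta> k * L \<le> 1 / 4" for k
  proof -
    have "\<eta> k * (4 * real n * L) \<le> 1" using assms(1,2) assms(6)[of k] by (simp add: pos_le_divide_eq)
    moreover have "\<eta> k * (4 * 1 * L) \<le> \<eta> k * (4 * real n * L)"
      using assms(1,2) assms(6)[of k] by (intro mult_left_mono mult_right_mono) auto
    ultimately have "\<eta> k * (4 * 1 * L) \<le> 1" by (rule order_trans[rotated])
    then show ?thesis using assms(6)[of k] by simp
  qed
  \<comment> \<open>Square-summability enters through the convergence of the step-sizes to
    0.\<close>
  have "(\<lambda>k. sqrt ((\<eta> k)\<^sup>2)) \<longlonglongrightarrow> sqrt 0"
    by (intro tendsto_real_sqrt summable_LIMSEQ_zero assms(8))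
  moreover have "sqrt ((\<eta> k)\<^sup>2) = \<eta> k" for k using \<eta>[of k] by simp
  ultimately have lim: "\<eta> \<longlonglongrightarrow> 0" by simp
  have div: "\<not> summable \<eta>"
    using not_tendsto_and_filterlim_at_infinity[OF sequentially_bot summable_LIMSEQ
        filterlim_at_top_imp_at_infinity[OF assms(7)]] by blast
  have null: "negligible {x. \<exists>l\<in>?SS. rr_iter n f \<eta> q x \<longlonglongrightarrow> l}" if "q \<in> space ?P" for q
  proof -
    have "q k permutes {1..n}" for k
      using that by (auto simp: space_PiM perm_space_def PiE_iff)
    from negligible_limit_strict_saddle[OF \<eta> this lim div] show ?thesis .
  qed
  \<comment> \<open>The bad event lives on pairs of a starting point and a permutation sequence; its
    slice at each fixed sequence is contained in the null set just found.\<close>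
  define W where "W = {w \<in> space (borel \<Otimes>\<^sub>M ?P). \<exists>l\<in>?SS. (\<lambda>k. rr_iter n f \<eta> (snd w) (fst w) k) \<longlonglongrightarrow> l}"
  have W: "W \<in> sets (borel \<Otimes>\<^sub>M ?P)"
    unfolding W_def
  proof (rule sets_Collect_tendsto_in[OF rr_iter_measurable strict_saddles_borel])
    show "(\<lambda>w. snd w k) \<in> measurable (borel \<Otimes>\<^sub>M ?P) (perm_space n)" for k
      by (rule measurable_compose[OF measurable_snd measurable_component_singleton]) simp
  qed simp
  let ?XY = "\<lambda>\<omega>. (X0 \<omega>, perms \<omega>)"
  have XY: "?XY \<in> measurable M (borel \<Otimes>\<^sub>M ?P)" using X0 perms by simp
  have "E = ?XY -` W \<inter> space M"
    using measurable_space[OF XY] by (auto simp: E_def W_def perms_def)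
  moreover have "?XY -` W \<inter> space M \<in> sets M" using XY W by (rule measurable_sets)
  moreover have "emeasure M (?XY -` W \<inter> space M) = 0"
  proof -
    let ?D1 = "distr M borel X0" and ?D2 = "distr M ?P perms"
    interpret D1: prob_space ?D1 by (rule prob_space_distr[OF X0])
    interpret D2: prob_space ?D2 by (rule prob_space_distr[OF perms])
    interpret pair_sigma_finite ?D1 ?D2 ..
    have D1: "?D1 = density lborel g"
    proof -
      \<comment> \<open>The density refers to the law on \<open>lborel\<close> and independence to
        the law on \<open>borel\<close>; the two have the same measurable sets.\<close>
      have "?D1 = distr M lborel X0" by (rule distr_cong) auto
      then show ?thesis using distributed_distr_eq_density[OF assms(10)] by simp
    qed
    have "emeasure ?D1 ((\<lambda>x. (x, q)) -` W) = 0" if q: "q \<in> space ?P" for q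
    proof -
      let ?Wq = "(\<lambda>x. (x, q)) -` W"
      have "negligible ?Wq" by (rule negligible_subset[OF null[OF q]]) (auto simp: W_def)
      moreover have "?Wq \<in> sets lborel" using sets_Pair2[OF W] by simp
      \<comment> \<open>Negligibility means null for the completed measure; since the slice is
        Borel, it is null for \<open>lborel\<close> itself and hence for the law of
        \<open>X0\<close>, which has a density.\<close>
      ultimately have "?Wq \<in> null_sets lborel"
        by (simp add: negligible_iff_null_sets null_sets_completion_iff)
      then have "?Wq \<in> null_sets ?D1"
        using absolutely_continuousI_density[OF distributed_borel_measurable[OF assms(10)]]
        by (auto simp: D1 absolutely_continuous_def)
      then show ?thesis by auto
    qed
    then have "(\<integral>\<^sup>+q. emeasure ?D1 ((\<lambda>x. (x, q)) -` W) \<partial>?D2) = (\<integral>\<^sup>+q. 0 \<partial>?D2)"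
      by (intro nn_integral_cong) simp
    moreover have "emeasure (?D1 \<Otimes>\<^sub>M ?D2) W = (\<integral>\<^sup>+q. emeasure ?D1 ((\<lambda>x. (x, q)) -` W) \<partial>?D2)"
      using W by (intro emeasure_pair_measure_alt2) (simp cong: sets_pair_measure_cong)
    ultimately have "emeasure (?D1 \<Otimes>\<^sub>M ?D2) W = 0" by simp
    then show ?thesis
      by (simp add: indep_rv_distr[OF ind] emeasure_distr[OF XY W])
  qed
  ultimately show ?thesis by (simp add: measure_def)
qed

end
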